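(* We have $$\left\{2\bar p_5(w)+\bar p_5(x)+\bar p_5(y)+\bar p_5(z):\ w,x,y,z\in\mathbb{N}\right\}=\mathbb{N}\setminus\{1,3,5,12,27,50\}.$$
   Context: $\mathbb{N}=\{0,1,2,\ldots\}$. For $n\in\mathbb{N}$, $\bar p_5(n)=\frac{n(3n+1)}2$ (the second pentagonal numbers). *)

theory Defs
  imports Main
begin

(* The division is exact: n and 3 * n + 1 have opposite parity. *)
definition second_pentagonal :: "nat \<Rightarrow> nat" where
  "second_pentagonal n = n * (3 * n + 1) div 2"

end

theory Submission
  imports Defs "HOL-Number_Theory.Number_Theory" "HOL-Computational_Algebra.Squarefree"
begin

text \<open>
  Put \<open>b = 2 w + x + y + z\<close> and \<open>a = 2 w\<^sup>2 + x\<^sup>2 + y\<^sup>2 + z\<^sup>2\<close>; a representation of \<open>N\<close> means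
  \<open>2 N = 3 a + b\<close>. As in Cauchy's proof of the polygonal number theorem, an integer solution
  \<open>w, x, y, z\<close> for given \<open>a\<close> and \<open>b\<close> is automatically nonnegative when \<open>4 a < b\<^sup>2 + 2 b + 5\<close>, and it exists
  as soon as \<open>5 a - b\<^sup>2\<close> is a value of \<open>5 (X\<^sup>2 + Y\<^sup>2 + Z\<^sup>2) - (X + Y + Z)\<^sup>2\<close>, where \<open>X = x - w\<close> etc.
  This ternary form represents every \<open>2 m\<close> with \<open>m\<close> congruent to 2 or 3 modulo 5. Indeed, as in the
  classical proof of the three squares theorem, one constructs a ternary form of half discriminant 5
  with value \<open>5 m\<close> from a prime with prescribed quadratic residue symbols, and reduction theory shows that
  all positive forms of half discriminant 5 are equivalent. Since only quadratic symbols are prescribed,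
  the part of Dirichlet's theorem for real characters suffices to find the prime.
\<close>

text \<open>Half the form in X, Y, Z has half discriminant 25. Its value m is reached through the
  value 5 m of a form of half discriminant 5, because there the reduction inequalities leave a
  single class. The condition on m comes from b: 5 a - b^2 = 2 m gives m congruent to 2 b^2 modulo
  5, so m is a nonresidue modulo 5 as soon as 5 does not divide b. The auxiliary prime q is 3 modulo
  8 and has (q/p) = (-5/p) for every odd prime p dividing m. This makes -5 q a square modulo m and,
  by reciprocity together with (m/5) = -1, makes -m a square modulo q; the coefficients of the form
  are built from these two roots. For given N the two inequalities confine b roughly to the interval
  from sqrt (8 N / 3) to sqrt (10 N / 3), while b must lie in a fixed class modulo 3 and avoid
  multiples of 5. Six consecutive integers always contain such a b, so only those N too small for
  the interval to hold them are left to a finite check.\<close>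

section \<open>Rearranging and bounding finite sums\<close>

lemma sum_divisors_swap:
  fixes F :: "nat \<Rightarrow> nat \<Rightarrow> 'a::comm_monoid_add"
  shows "(\<Sum>n=1..N. \<Sum>d | d dvd n. F d (n div d)) = (\<Sum>d=1..N. \<Sum>e=1..N div d. F d e)"
proof -
  have "(\<Sum>n=1..N. \<Sum>d | d dvd n. F d (n div d)) =
        (\<Sum>(n, d)\<in>(SIGMA n:{1..N}. {d. d dvd n}). F d (n div d))"
    by (subst sum.Sigma) auto
  also have "\<dots> = (\<Sum>(d, e)\<in>(SIGMA d:{1..N}. {1..N div d}). F d e)"
  proof (rule sum.reindex_bij_witness[of _ "\<lambda>(d, e). (d * e, d)" "\<lambda>(n, d). (d, n div d)"], goal_cases)
    case (2 nd)
    then obtain n d where nd: "nd = (n, d)" "n \<in> {1..N}" "d dvd n" by auto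
    then have "d \<le> n" "d > 0" "0 < n div d"
      by (auto dest: dvd_imp_le intro: Nat.gr0I simp: dvd_div_eq_0_iff)
    with nd show ?case by (auto intro: div_le_mono)
  next
    case (4 de)
    then obtain d e where de: "de = (d, e)" "1 \<le> d" "d \<le> N" "1 \<le> e" "e \<le> N div d" by auto
    then have "e * d \<le> N" by (simp add: less_eq_div_iff_mult_less_eq)
    with de show ?case by (auto simp: mult.commute)
  qed auto
  also have "\<dots> = (\<Sum>d=1..N. \<Sum>e=1..N div d. F d e)"
    by (subst sum.Sigma) auto
  finally show ?thesis .
qed

text \<open>Summation by parts: the partial sums of \<open>c\<close> are bounded and the decrements
  of \<open>w\<close> are nonnegative and telescope, so the bound does not depend on
  \<open>b\<close>.\<close>

lemma abs_sum_mult_antimono_le: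
  fixes c w :: "nat \<Rightarrow> real"
  assumes bound: "\<And>j. j \<ge> a \<Longrightarrow> \<bar>\<Sum>n\<in>{a..<j}. c n\<bar> \<le> B"
    and anti: "\<And>n. n \<ge> a \<Longrightarrow> w (Suc n) \<le> w n" and nonneg: "\<And>n. n \<ge> a \<Longrightarrow> 0 \<le> w n"
    and "a \<le> b"
  shows "\<bar>\<Sum>n\<in>{a..<b}. c n * w n\<bar> \<le> B * w a"
proof -
  define T where "T j = (\<Sum>n\<in>{a..<j}. c n)" for j
  have "(\<Sum>n\<in>{a..<b}. c n * w n) = T b * w b + (\<Sum>n\<in>{a..<b}. T (Suc n) * (w n - w (Suc n)))"
    using \<open>a \<le> b\<close> by (induction b rule: dec_induct) (simp_all add: T_def algebra_simps)
  also have "\<bar>\<dots>\<bar> \<le> B * w b + (\<Sum>n\<in>{a..<b}. B * (w n - w (Suc n)))"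
  proof (rule order.trans[OF abs_triangle_ineq add_mono])
    show "\<bar>T b * w b\<bar> \<le> B * w b"
      using bound[of b] nonneg[of b] \<open>a \<le> b\<close> by (auto simp: abs_mult T_def intro: mult_right_mono)
    show "\<bar>\<Sum>n\<in>{a..<b}. T (Suc n) * (w n - w (Suc n))\<bar> \<le> (\<Sum>n\<in>{a..<b}. B * (w n - w (Suc n)))"
    proof (rule order.trans[OF sum_abs sum_mono])
      fix n assume n: "n \<in> {a..<b}"
      show "\<bar>T (Suc n) * (w n - w (Suc n))\<bar> \<le> B * (w n - w (Suc n))"
        using bound[of "Suc n"] anti[of n] n unfolding abs_mult T_def by (intro mult_mono) auto
    qed
  qed
  also have "\<dots> = B * w a"
    using \<open>a \<le> b\<close> by (induction b rule: dec_induct) (simp_all add: algebra_simps)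
  finally show ?thesis .
qed

section \<open>Chebyshev and Mertens bounds\<close>

text \<open>Logarithmic form of Legendre's formula for N!; both the Chebyshev upper bound and the
  Mertens lower bound come from it.\<close>

lemma ln_fact_eq_sum_mangoldt: "ln (fact N) = (\<Sum>d=1..N. mangoldt d * real (N div d))"
proof -
  have "ln (fact N :: real) = (\<Sum>n=1..N. ln (real n))"
    by (subst ln_prod[symmetric]) (auto simp: fact_prod)
  also have "\<dots> = (\<Sum>n=1..N. \<Sum>d | d dvd n. mangoldt d)"
    by (intro sum.cong) (auto simp: mangoldt_sum)
  also have "\<dots> = (\<Sum>d=1..N. mangoldt d * real (N div d))"
    by (subst sum_divisors_swap) (simp add: mult.commute)
  finally show ?thesis .
qed

lemma mangoldt_le_ln: "n > 0 \<Longrightarrow> mangoldt n \<le> ln (real n)"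
proof -
  assume n: "n > 0"
  then have "mangoldt n \<le> (\<Sum>d | d dvd n. mangoldt d :: real)"
    by (intro member_le_sum) (auto simp: mangoldt_nonneg)
  also have "\<dots> = ln (real n)" using n by (subst mangoldt_sum) auto
  finally show ?thesis .
qed

text \<open>In ln (2n)! - 2 ln n! each d of the range has weight exactly 1 and every other d a
  nonnegative weight; the difference is the logarithm of a central binomial coefficient, which is at
  most 4^n.\<close>

lemma sum_mangoldt_double: "(\<Sum>d\<in>{n<..2*n}. mangoldt d) \<le> real n * ln 4"
proof -
  have "(\<Sum>d\<in>{n<..2*n}. mangoldt d) \<le> (\<Sum>d=1..2*n. mangoldt d * (real (2*n div d) - 2 * real (n div d)))"
  proof (rule order.trans[OF _ sum_mono2[of "{1..2*n}" "{n<..2*n}"]])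
    show "(\<Sum>d\<in>{n<..2*n}. mangoldt d)
      \<le> (\<Sum>d\<in>{n<..2*n}. mangoldt d * (real (2*n div d) - 2 * real (n div d)))"
    proof (rule sum_mono)
      fix d assume d: "d \<in> {n<..2*n}"
      then have "2*n div d = 1" by (auto intro: div_nat_eqI)
      with d show "mangoldt d \<le> mangoldt d * (real (2*n div d) - 2 * real (n div d))" by auto
    qed
    fix d
    have "2 * (n div d) \<le> 2 * n div d" by (cases "d = 0") (auto simp: less_eq_div_iff_mult_less_eq)
    then have "2 * real (n div d) \<le> real (2 * n div d)" by linarith
    then show "0 \<le> mangoldt d * (real (2*n div d) - 2 * real (n div d))"
      by (intro mult_nonneg_nonneg) (auto simp: mangoldt_nonneg)
  qed auto
  also have "\<dots> = (\<Sum>d=1..2*n. mangoldt d * real (2*n div d)) - 2 * (\<Sum>d=1..2*n. mangoldt d * real (n div d))"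
    by (simp add: algebra_simps sum_subtractf sum_distrib_left)
  also have "(\<Sum>d=1..2*n. mangoldt d * real (n div d)) = (\<Sum>d=1..n. mangoldt d * real (n div d))"
    by (rule sum.mono_neutral_right) auto
  also have "(\<Sum>d=1..2*n. mangoldt d * real (2*n div d)) - 2 * \<dots> = ln (fact (2*n)) - 2 * ln (fact n)"
    by (simp only: ln_fact_eq_sum_mangoldt)
  also have "\<dots> = ln (real (2 * n choose n))"
    by (subst binomial_fact) (auto simp: ln_div ln_mult)
  also have "\<dots> \<le> ln (2 ^ (2 * n))"
    by (subst ln_le_cancel_iff) (use binomial_le_pow2[of "2*n" n] in \<open>auto simp flip: of_nat_le_iff\<close>)
  also have "\<dots> = real n * ln 4" by (simp add: ln_realpow power_mult)
  finally show ?thesis .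
qed

text \<open>Chebyshev's bound by halving n. The constant 4 is generous enough to absorb the crude
  estimate \<open>mangoldt n \<le> n\<close> for the leftover term when n is odd.\<close>

lemma sum_mangoldt_le: "(\<Sum>d=1..n. mangoldt d) \<le> 4 * real n"
proof (induction n rule: less_induct)
  case (less n)
  show ?case
  proof (cases "n = 0")
    case False
    define m where "m = n div 2"
    have m: "m < n" using False by (simp add: m_def)
    have ln4: "ln (4::real) \<le> 2"
    proof -
      have "ln (4::real) = 2 * ln 2" using ln_realpow[of 2 2] by simp
      then show ?thesis using ln_2_less_1 by simp
    qed
    have split: "(\<Sum>d=1..2*m. mangoldt d :: real) = (\<Sum>d=1..m. mangoldt d) + (\<Sum>d\<in>{m<..2*m}. mangoldt d)"
      by (subst sum.union_disjoint[symmetric]) (auto intro!: sum.cong)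
    have "(\<Sum>d=1..n. mangoldt d :: real) =
      (\<Sum>d=1..m. mangoldt d) + (\<Sum>d\<in>{m<..2*m}. mangoldt d) + (if odd n then mangoldt n else 0)"
    proof (cases "odd n")
      case True
      then have "n = Suc (2 * m)" by (simp add: m_def)
      then show ?thesis using split by simp
    next
      case even: False
      then have "n = 2 * m" by (simp add: m_def)
      then show ?thesis using split even by simp
    qed
    also have "\<dots> \<le> 4 * real m + real m * 2 + (if odd n then real n else 0)"
    proof (intro add_mono)
      show "(\<Sum>d\<in>{m<..2*m}. mangoldt d) \<le> real m * 2"
        using sum_mangoldt_double[of m] mult_left_mono[OF ln4, of "real m"] by linarith
      have "mangoldt n \<le> real n"
        using mangoldt_le_ln[of n] ln_le_minus_one[of "real n"] False by simp
      then show "(if odd n then mangoldt n else 0) \<le> (if odd n then real n else 0)" by simp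
    qed (use less[OF m] in auto)
    also have "\<dots> \<le> 4 * real n"
      unfolding m_def by (auto elim!: evenE oddE)
    finally show ?thesis .
  qed auto
qed

text \<open>Lower half of Mertens' first theorem: the bound N ln N - N for ln N! is played against
  Legendre's formula with \<open>N div d\<close> enlarged to N / d.\<close>

lemma sum_mangoldt_div_ge: "N > 0 \<Longrightarrow> (\<Sum>d=1..N. mangoldt d / real d) \<ge> ln (real N) - 1"
proof -
  assume N: "N > 0"
  have "real N * (ln (real N) - 1) \<le> ln (fact N)"
    using N
  proof (induction N rule: nat_induct_non_zero)
    case (Suc n)
    have "ln (real n + 1) - ln (real n) \<le> 1 / real n"
      using ln_diff_le[of "real n + 1" "real n"] Suc.hyps by simp
    then have "real n * (ln (real n + 1) - ln (real n)) \<le> 1"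
      using Suc.hyps by (simp add: field_simps)
    moreover have "ln (fact (Suc n)) = ln (real n + 1) + ln (fact n)"
      by (simp add: ln_mult add.commute)
    ultimately show ?case using Suc.IH by (simp add: algebra_simps)
  qed simp
  also have "\<dots> \<le> (\<Sum>d=1..N. mangoldt d * (real N / real d))"
    unfolding ln_fact_eq_sum_mangoldt
    by (intro sum_mono mult_left_mono of_nat_div_le_of_nat mangoldt_nonneg)
  also have "\<dots> = real N * (\<Sum>d=1..N. mangoldt d / real d)"
    by (simp add: sum_distrib_left algebra_simps)
  finally show ?thesis using N by simp
qed

section \<open>Real characters\<close>

text \<open>Every divisor of p^a m is p^i d for a unique i at most a and a unique divisor d of m.
  This splits off the Euler factor at p in inductions over the prime factorization.\<close>

lemma sum_divisors_prime_power_mult: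
  fixes f :: "nat \<Rightarrow> 'a::comm_semiring_1"
  assumes mult: "\<And>a b. f (a * b) = f a * f b" and one: "f 1 = 1"
    and p: "prime p" "\<not> p dvd m" and "m > 0"
  shows "(\<Sum>d | d dvd p ^ a * m. f d) = (\<Sum>i\<le>a. f p ^ i) * (\<Sum>d | d dvd m. f d)"
proof -
  have power: "f (p ^ i) = f p ^ i" for i
    using one by (induction i) (simp_all add: mult)
  have mult_power: "multiplicity p (p ^ i * d) = i" if "\<not> p dvd d" for i d
  proof -
    have "multiplicity p (p ^ i * d) = multiplicity p (p ^ i) + multiplicity p d"
      using p(1) that by (intro prime_elem_multiplicity_mult_distrib) (auto intro: Nat.gr0I)
    then show ?thesis using p(1) that by (simp add: not_dvd_imp_multiplicity_0)
  qed
  have "bij_betw (\<lambda>(i, d). p ^ i * d) ({..a} \<times> {d. d dvd m}) {d. d dvd p ^ a * m}"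
  proof (rule bij_betwI')
    fix x y assume x: "x \<in> {..a} \<times> {d. d dvd m}" and y: "y \<in> {..a} \<times> {d. d dvd m}"
    obtain i d j e where xy: "x = (i, d)" "y = (j, e)" by (cases x, cases y)
    have nd: "\<not> p dvd d" "\<not> p dvd e" using x y p(2) xy by (auto dest: dvd_trans)
    have "multiplicity p (p ^ i * d) = i" "multiplicity p (p ^ j * e) = j"
      using mult_power[OF nd(1)] mult_power[OF nd(2)] by simp_all
    then show "((case x of (i, d) \<Rightarrow> p ^ i * d) = (case y of (i, d) \<Rightarrow> p ^ i * d)) = (x = y)"
      using p(1) by (auto simp: xy prime_gt_0_nat)
  next
    fix x assume "x \<in> {..a} \<times> {d. d dvd m}"
    then show "(case x of (i, d) \<Rightarrow> p ^ i * d) \<in> {d. d dvd p ^ a * m}"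
      by (auto intro: mult_dvd_mono le_imp_power_dvd)
  next
    fix y assume "y \<in> {d. d dvd p ^ a * m}"
    then obtain b c where "y = b * c" "b dvd p ^ a" "c dvd m"
      using division_decomp by blast
    moreover from this p(1) obtain i where "i \<le> a" "b = p ^ i"
      by (auto simp: divides_primepow_nat)
    ultimately show "\<exists>x\<in>{..a} \<times> {d. d dvd m}. y = (case x of (i, d) \<Rightarrow> p ^ i * d)"
      by (intro bexI[of _ "(i, c)"]) auto
  qed
  then have "(\<Sum>d | d dvd p ^ a * m. f d) = (\<Sum>(i, d)\<in>{..a} \<times> {d. d dvd m}. f (p ^ i * d))"
    by (simp add: sum.reindex_bij_betw[symmetric] case_prod_unfold)
  also have "\<dots> = (\<Sum>i\<le>a. f p ^ i) * (\<Sum>d | d dvd m. f d)"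
    by (simp add: mult power sum_product sum.cartesian_product)
  finally show ?thesis .
qed

lemma sqrt_Suc_diff_ge: "1 / sqrt (real (Suc n)) \<le> 2 * (sqrt (real (Suc n)) - sqrt (real n))"
proof -
  have "(sqrt (real (Suc n)) - sqrt (real n)) * (sqrt (real (Suc n)) + sqrt (real n)) = 1"
    by (simp add: algebra_simps)
  moreover have "(sqrt (real (Suc n)) - sqrt (real n)) * (sqrt (real (Suc n)) + sqrt (real n))
     \<le> (sqrt (real (Suc n)) - sqrt (real n)) * (2 * sqrt (real (Suc n)))"
    by (intro mult_left_mono) auto
  ultimately show ?thesis by (simp add: field_simps)
qed

lemma sqrt_Suc_diff_le:
  assumes "n > 0"
  shows "2 * (sqrt (real (Suc n)) - sqrt (real n)) \<le> 1 / sqrt (real n)"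
proof -
  define s t where "s = sqrt (real n)" and "t = sqrt (real (Suc n))"
  have st: "s > 0" "t \<ge> s" using assms by (auto simp: s_def t_def)
  have "(t - s) * (t + s) = 1" by (simp add: s_def t_def algebra_simps)
  then have "t - s = 1 / (t + s)" using st by (intro eq_divide_imp) auto
  also have "\<dots> \<le> 1 / (s + s)" using st by (intro frac_le) auto
  finally have "2 * (t - s) \<le> 1 / s" by simp
  then show ?thesis by (simp only: s_def t_def)
qed

text \<open>The difference D of the sum and 2 sqrt n decreases, E = D - 1 / sqrt n increases, and
  every E lies below every D; c is their common limit, which is zeta(1/2).\<close>

lemma sum_inverse_sqrt_asymp:
  obtains c :: real where
    "\<And>n. n > 0 \<Longrightarrow> \<bar>(\<Sum>e=1..n. 1 / sqrt (real e)) - 2 * sqrt (real n) - c\<bar> \<le> 1 / sqrt (real n)"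
proof -
  define D where "D n = (\<Sum>e=1..n. 1 / sqrt (real e)) - 2 * sqrt (real n)" for n
  define E where "E n = D n - 1 / sqrt (real n)" for n
  have D_Suc: "D (Suc n) \<le> D n" for n
    using sqrt_Suc_diff_ge[of n] by (simp add: D_def)
  have E_Suc: "E n \<le> E (Suc n)" if "n > 0" for n
    using sqrt_Suc_diff_le[OF that] by (simp add: D_def E_def)
  have D_anti: "D n \<le> D m" if "0 < m" "m \<le> n" for m n
    using that(2,1) by (induction n rule: dec_induct) (auto intro: order.trans[OF D_Suc])
  have E_mono: "E m \<le> E n" if "0 < m" "m \<le> n" for m n
    using that(2,1) by (induction n rule: dec_induct) (auto intro: order.trans[OF _ E_Suc])
  have E_le_D: "E m \<le> D n" if "0 < m" "0 < n" for m n
  proof -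
    have "E m \<le> E (max m n)" "D (max m n) \<le> D n" using that by (auto intro: D_anti E_mono)
    moreover have "E (max m n) \<le> D (max m n)" by (simp add: E_def)
    ultimately show ?thesis by linarith
  qed
  define c where "c = (SUP n\<in>{0<..}. E n)"
  have bdd: "bdd_above (E ` {0<..})" using E_le_D[of _ 1] by (auto intro!: bdd_aboveI2)
  have "\<bar>D n - c\<bar> \<le> 1 / sqrt (real n)" if "n > 0" for n
  proof -
    have "c \<le> D n" unfolding c_def using that E_le_D by (intro cSUP_least) auto
    moreover have "E n \<le> c" unfolding c_def using that bdd by (intro cSUP_upper) auto
    ultimately show ?thesis by (auto simp: E_def)
  qed
  then show ?thesis using that unfolding D_def by blast
qed

lemma sum_inverse_sqrt_le: "(\<Sum>e=1..n. 1 / sqrt (real e)) \<le> 2 * sqrt (real n)"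
proof (induction n)
  case (Suc n)
  with sqrt_Suc_diff_ge[of n] show ?case by simp
qed simp

text \<open>Real Dirichlet characters with period \<open>k\<close>; \<open>sum_period\<close> is
  what excludes the principal one.\<close>

locale real_character =
  fixes k :: nat and \<chi> :: "nat \<Rightarrow> real"
  assumes k_pos: "k > 0"
    and mult: "\<chi> (a * b) = \<chi> a * \<chi> b"
    and one: "\<chi> 1 = 1"
    and sign_values: "\<chi> n \<in> {-1, 0, 1}"
    and periodic: "\<chi> (n + k) = \<chi> n"
    and sum_period: "(\<Sum>n<k. \<chi> n) = 0"
begin

lemma zero: "\<chi> 0 = 0"
proof (rule ccontr)
  assume "\<chi> 0 \<noteq> 0"
  then have "\<chi> n = 1" for n using mult[of 0 n] by simp
  then show False using sum_period k_pos by simp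
qed

lemma abs_le_1: "\<bar>\<chi> n\<bar> \<le> 1"
  using sign_values[of n] by auto

text \<open>Complete periods cancel, so fewer than \<open>k\<close> terms of absolute value at most
  1 remain.\<close>

lemma abs_sum_lessThan_le: "\<bar>\<Sum>i<n. \<chi> i\<bar> \<le> real k"
proof -
  have shift: "(\<Sum>i<n + k. \<chi> i) = (\<Sum>i<n. \<chi> i)" for n
    by (induction n) (simp_all add: sum_period periodic)
  have "(\<Sum>i<r + q * k. \<chi> i) = (\<Sum>i<r. \<chi> i)" for r q
    by (induction q) (simp_all add: shift flip: add.assoc, metis add.assoc add.commute shift)
  from this[of "n mod k" "n div k"] have "(\<Sum>i<n. \<chi> i) = (\<Sum>i<n mod k. \<chi> i)"
    by simp
  also have "\<bar>\<dots>\<bar> \<le> (\<Sum>i<n mod k. 1)"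
    by (rule order.trans[OF sum_abs sum_mono]) (rule abs_le_1)
  also have "\<dots> \<le> real k" using k_pos by (simp add: less_imp_le)
  finally show ?thesis .
qed

lemma abs_weighted_sum_le:
  assumes "\<And>n. n > a \<Longrightarrow> w (Suc n) \<le> w n" "\<And>n. n > a \<Longrightarrow> 0 \<le> w n" "a \<le> b"
  shows "\<bar>\<Sum>n\<in>{a<..b}. \<chi> n * w n\<bar> \<le> 2 * real k * w (Suc a)"
proof -
  have "\<bar>\<Sum>n\<in>{Suc a..<j}. \<chi> n\<bar> \<le> 2 * real k" if "j \<ge> Suc a" for j
  proof -
    have "(\<Sum>n\<in>{Suc a..<j}. \<chi> n) = (\<Sum>i<j. \<chi> i) - (\<Sum>i<Suc a. \<chi> i)"
      using that sum_diff_nat_ivl[of 0 "Suc a" j \<chi>] by (simp add: atLeast0LessThan)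
    then show ?thesis using abs_sum_lessThan_le[of j] abs_sum_lessThan_le[of "Suc a"] by linarith
  qed
  moreover have "{a<..b} = {Suc a..<Suc b}" by auto
  ultimately show ?thesis
    using assms abs_sum_mult_antimono_le[of "Suc a" \<chi> "2 * real k" w "Suc b"] by simp
qed

text \<open>The tail bound makes the partial sums Cauchy. The limit is recorded through its error
  because later estimates use the rate; for w n = 1 / n it is L(1, \<chi>).\<close>

lemma weighted_series_limit:
  assumes anti: "\<And>n. n > 0 \<Longrightarrow> w (Suc n) \<le> w n" and nonneg: "\<And>n. n > 0 \<Longrightarrow> 0 \<le> w n"
    and lim: "w \<longlonglongrightarrow> 0"
  obtains L where "\<And>m. \<bar>(\<Sum>n=1..m. \<chi> n * w n) - L\<bar> \<le> 2 * real k * w (Suc m)"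
proof -
  define P where "P m = (\<Sum>n=1..m. \<chi> n * w n)" for m
  have diff: "\<bar>P n - P m\<bar> \<le> 2 * real k * w (Suc m)" if "m \<le> n" for m n
  proof -
    have "{1..n} = {1..m} \<union> {m<..n}" using that by auto
    then have "P n = P m + (\<Sum>i\<in>{m<..n}. \<chi> i * w i)"
      unfolding P_def by (subst sum.union_disjoint[symmetric]) auto
    then show ?thesis using abs_weighted_sum_le[of m w n] anti nonneg that by simp
  qed
  have lim': "(\<lambda>m. 2 * real k * w (Suc m)) \<longlonglongrightarrow> 0"
    using tendsto_mult_right_zero[OF LIMSEQ_Suc[OF lim]] by simp
  have "Cauchy P"
  proof (rule CauchyI')
    fix e :: real assume "e > 0"
    then obtain M where M: "\<And>m. m \<ge> M \<Longrightarrow> \<bar>2 * real k * w (Suc m)\<bar> < e"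
      using lim' by (auto simp: LIMSEQ_iff)
    show "\<exists>M. \<forall>m\<ge>M. \<forall>n>m. dist (P m) (P n) < e"
    proof (intro exI[of _ M] allI impI)
      fix m n assume "M \<le> m" "m < n"
      then show "dist (P m) (P n) < e"
        using M[of m] diff[of m n] by (simp add: dist_real_def abs_minus_commute)
    qed
  qed
  then obtain L where L: "P \<longlonglongrightarrow> L" by (auto simp: Cauchy_convergent_iff convergent_def)
  have "\<bar>P m - L\<bar> \<le> 2 * real k * w (Suc m)" for m
  proof -
    have "(\<lambda>n. \<bar>P n - P m\<bar>) \<longlonglongrightarrow> \<bar>L - P m\<bar>" by (intro tendsto_intros L)
    then have "\<bar>L - P m\<bar> \<le> 2 * real k * w (Suc m)"
      by (rule LIMSEQ_le_const2) (use diff in blast)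
    then show ?thesis by (simp add: abs_minus_commute)
  qed
  then show ?thesis using that unfolding P_def by blast
qed

text \<open>For \<chi> p = -1 the sum alternates between 1 and 0. Only even exponents guarantee at
  least 1, which is why squares are singled out later.\<close>

lemma sum_power_ge: "(\<Sum>i\<le>a. \<chi> p ^ i) \<ge> (if even a then 1 else 0)"
proof -
  have "\<chi> p = 0 \<Longrightarrow> (\<Sum>i\<le>a. \<chi> p ^ i) = 1" by (simp add: power_0_left sum.delta)
  moreover have "\<chi> p = -1 \<Longrightarrow> (\<Sum>i\<le>a. \<chi> p ^ i) = (if even a then 1 else 0)"
    by (induction a) auto
  moreover have "\<chi> p = 1 \<Longrightarrow> (\<Sum>i\<le>a. \<chi> p ^ i) \<ge> 1" by simp
  ultimately show ?thesis using sign_values[of p] by auto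
qed

text \<open>Stripping the full power of one prime splits the sum into a local factor, nonnegative by
  \<open>sum_power_ge\<close>, and the sum for a smaller number.\<close>

lemma sum_divisors_ge_0: "n > 0 \<Longrightarrow> (\<Sum>d | d dvd n. \<chi> d) \<ge> 0"
proof (induction n rule: less_induct)
  case (less n)
  show ?case
  proof (cases "n = 1")
    case False
    then obtain p where p: "prime p" "p dvd n" using prime_factor_nat by blast
    have "\<not> is_unit p" using p(1) not_prime_unit by blast
    then obtain m where m: "n = p ^ multiplicity p n * m" "\<not> p dvd m"
      using multiplicity_decompose'[of n p] less.prems by auto
    have "multiplicity p n > 0" using p less.prems by (simp add: prime_multiplicity_gt_zero_iff)
    then have "1 < p ^ multiplicity p n" by (intro one_less_power prime_gt_1_nat[OF p(1)])
    moreover have "m > 0" using m(2) by (auto intro: Nat.gr0I)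
    ultimately have "m < n" using m(1) by (metis nat_mult_1 mult_less_mono1)
    then have "(\<Sum>d | d dvd m. \<chi> d) \<ge> 0" using less.IH \<open>m > 0\<close> by blast
    moreover have "(\<Sum>i\<le>multiplicity p n. \<chi> p ^ i) \<ge> 0"
      by (rule order.trans[OF _ sum_power_ge]) simp
    ultimately show ?thesis
      by (subst m(1), subst sum_divisors_prime_power_mult)
         (use mult one p m \<open>m > 0\<close> in auto)
  qed (simp add: one[simplified])
qed

text \<open>The same induction; in a square all exponents are even, so every local factor is at
  least 1.\<close>

lemma sum_divisors_square_ge_1: "s > 0 \<Longrightarrow> (\<Sum>d | d dvd s\<^sup>2. \<chi> d) \<ge> 1"
proof (induction s rule: less_induct)
  case (less s)
  show ?case
  proof (cases "s = 1")
    case False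
    then obtain p where p: "prime p" "p dvd s" using prime_factor_nat by blast
    have "\<not> is_unit p" using p(1) not_prime_unit by blast
    then obtain m where m: "s = p ^ multiplicity p s * m" "\<not> p dvd m"
      using multiplicity_decompose'[of s p] less.prems by auto
    have "multiplicity p s > 0" using p less.prems by (simp add: prime_multiplicity_gt_zero_iff)
    then have "1 < p ^ multiplicity p s" by (intro one_less_power prime_gt_1_nat[OF p(1)])
    moreover have "m > 0" using m(2) by (auto intro: Nat.gr0I)
    ultimately have "m < s" using m(1) by (metis nat_mult_1 mult_less_mono1)
    then have "(\<Sum>d | d dvd m\<^sup>2. \<chi> d) \<ge> 1" using less.IH \<open>m > 0\<close> by blast
    moreover have "(\<Sum>i\<le>2 * multiplicity p s. \<chi> p ^ i) \<ge> 1"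
      by (rule order.trans[OF _ sum_power_ge]) simp
    ultimately have "(\<Sum>i\<le>2 * multiplicity p s. \<chi> p ^ i) * (\<Sum>d | d dvd m\<^sup>2. \<chi> d) \<ge> 1 * 1"
      by (intro mult_mono) auto
    moreover have "s\<^sup>2 = p ^ (2 * multiplicity p s) * m\<^sup>2"
      by (subst m(1)) (simp add: power_mult_distrib power_even_eq flip: power_mult)
    ultimately show ?thesis
      by (simp only:, subst sum_divisors_prime_power_mult)
         (use mult one p m \<open>m > 0\<close> in \<open>auto simp: prime_dvd_power_iff\<close>)
  qed (simp add: one[simplified])
qed

end

section \<open>Nonvanishing of L(1, \<chi>) and boundedness of the twisted Mertens sum\<close>

lemma ln_le_harmonic_sum: "ln (real n + 1) \<le> (\<Sum>s=1..n. 1 / real s)"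
proof (induction n)
  case (Suc n)
  have "ln (real n + 2) - ln (real n + 1) \<le> 1 / (real n + 1)"
    using ln_diff_le[of "real n + 2" "real n + 1"] by simp
  then show ?case using Suc by (simp add: add.commute)
qed simp

text \<open>Flooring N / d loses at most 1, and a difference of square roots is the difference of
  the radicands over the sum of the roots.\<close>

lemma sqrt_diff_nat_div_le:
  assumes "0 < d" "d \<le> N"
  shows "\<bar>sqrt (real N / real d) - sqrt (real (N div d))\<bar> \<le> 1 / (2 * sqrt (real (N div d)))"
proof -
  define s t where "s = sqrt (real (N div d))" and "t = sqrt (real N / real d)"
  have s: "s > 0" using assms by (simp add: s_def div_greater_zero_iff)
  have "real (N div d) \<le> real N / real d" by (rule of_nat_div_le_of_nat)
  then have st: "s \<le> t" by (simp add: s_def t_def)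
  have "real N / real d - real (N div d) \<le> 1"
  proof -
    have "N < Suc (N div d) * d" using assms(1) by (simp add: dividend_less_div_times)
    then have "real N < real (Suc (N div d)) * real d" by (metis of_nat_less_iff of_nat_mult)
    then show ?thesis using assms(1) by (simp add: divide_le_eq algebra_simps)
  qed
  then have "(t - s) * (t + s) \<le> 1" by (simp add: s_def t_def algebra_simps)
  then have "(t - s) * (2 * s) \<le> 1"
    using mult_left_mono[of "2 * s" "t + s" "t - s"] st by simp
  then have "t - s \<le> 1 / (2 * s)" using s by (simp add: field_simps)
  then show ?thesis using st by (simp flip: s_def t_def)
qed

context real_character
begin

text \<open>Dirichlet's hyperbola method for the sum of \<open>(\<Sum>d | d dvd n. \<chi> d) / sqrt n\<close> over \<open>n \<le> M\<^sup>2\<close>: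
  it would be bounded if the series \<open>\<chi> n / n\<close> summed to 0, although the squares alone
  contribute at least the harmonic sum.\<close>

lemma series_limit_nonzero:
  assumes L: "\<And>m. \<bar>(\<Sum>n=1..m. \<chi> n * (1 / real n)) - L\<bar> \<le> 2 * real k * (1 / real (Suc m))"
  shows "L \<noteq> 0"
proof
  assume "L = 0"
  define H where "H n = (\<Sum>e=1..n. 1 / sqrt (real e))" for n
  obtain c where c: "\<And>n. n > 0 \<Longrightarrow> \<bar>H n - 2 * sqrt (real n) - c\<bar> \<le> 1 / sqrt (real n)"
    unfolding H_def using sum_inverse_sqrt_asymp by metis
  have X_le: "\<bar>\<Sum>d\<in>{a<..b}. \<chi> d * (1 / sqrt (real d))\<bar> \<le> 2 * real k * (1 / sqrt (real (Suc a)))" for a b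
  proof (cases "a \<le> b")
    case True
    then show ?thesis by (intro abs_weighted_sum_le) (auto intro!: frac_le)
  qed simp
  \<comment> \<open>The summands bound, in this order: the error in the asymptotics of
    \<open>H\<close>, the partial sum of L(1, \<chi>), the contribution of the constant
    \<open>c\<close>, and the divisors d > M.\<close>
  define B where "B = 4 + 4 * real k + \<bar>c\<bar> * (2 * real k) + 4 * real k"
  have upper: "ln (real M + 1) \<le> B" if M: "M > 0" for M
  proof -
    define g where "g d = \<chi> d * (1 / sqrt (real d))" for d
    define T where "T = (\<Sum>n=1..M\<^sup>2. \<Sum>d | d dvd n. g d * (1 / sqrt (real (n div d))))"
    have inner: "(\<Sum>d | d dvd n. g d * (1 / sqrt (real (n div d)))) = (\<Sum>d | d dvd n. \<chi> d) * (1 / sqrt (real n))"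
      for n
      unfolding sum_distrib_right
    proof (rule sum.cong)
      fix d assume "d \<in> {d. d dvd n}"
      then obtain e where "n = d * e" by auto
      then show "g d * (1 / sqrt (real (n div d))) = \<chi> d * (1 / sqrt (real n))"
        by (cases "d = 0") (auto simp: g_def real_sqrt_mult zero)
    qed auto
    have "ln (real M + 1) \<le> (\<Sum>s=1..M. 1 / real s)" by (rule ln_le_harmonic_sum)
    also have "\<dots> \<le> (\<Sum>s=1..M. (\<Sum>d | d dvd s\<^sup>2. \<chi> d) * (1 / sqrt (real (s\<^sup>2))))"
      by (intro sum_mono) (use sum_divisors_square_ge_1 in \<open>auto simp: divide_right_mono\<close>)
    also have "\<dots> = (\<Sum>n\<in>(\<lambda>s. s\<^sup>2) ` {1..M}. (\<Sum>d | d dvd n. \<chi> d) * (1 / sqrt (real n)))"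
      by (subst sum.reindex) (auto simp: inj_on_def)
    also have "\<dots> \<le> T"
      unfolding T_def inner
      by (intro sum_mono2) (auto simp: power_mono sum_divisors_ge_0 Suc_le_eq)
    also have "T = (\<Sum>d=1..M\<^sup>2. g d * H (M\<^sup>2 div d))"
      unfolding T_def H_def sum_distrib_left by (rule sum_divisors_swap)
    \<comment> \<open>The hyperbola is cut at d = M. For d > M the order of summation is exchanged,
      so that the cancellation of \<chi> over a long range gives O(1 / sqrt M) against
      \<open>H M\<close> = O(sqrt M); for d up to M the asymptotics of \<open>H\<close> are
      used.\<close>
    also have "\<dots> = (\<Sum>d=1..M. g d * H (M\<^sup>2 div d)) + (\<Sum>d\<in>{M<..M\<^sup>2}. g d * H (M\<^sup>2 div d))"
    proof (subst sum.union_disjoint[symmetric])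
      have "M \<le> M\<^sup>2" using M by (simp add: power2_eq_square)
      then show "(\<Sum>d=1..M\<^sup>2. g d * H (M\<^sup>2 div d)) = (\<Sum>d\<in>{1..M} \<union> {M<..M\<^sup>2}. g d * H (M\<^sup>2 div d))"
        by (intro sum.cong) auto
    qed auto
    also have "(\<Sum>d\<in>{M<..M\<^sup>2}. g d * H (M\<^sup>2 div d)) =
        (\<Sum>d\<in>{M<..M\<^sup>2}. \<Sum>e\<in>{e\<in>{1..M}. d * e \<le> M\<^sup>2}. g d * (1 / sqrt (real e)))"
    proof (rule sum.cong)
      fix d assume d: "d \<in> {M<..M\<^sup>2}"
      have "e \<le> M" if "d * e \<le> M\<^sup>2" for e
      proof (rule ccontr)
        assume "\<not> e \<le> M"
        then have "M * M < d * e" using d by (intro mult_strict_mono) auto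
        then show False using that by (simp add: power2_eq_square)
      qed
      then have "{1..M\<^sup>2 div d} = {e\<in>{1..M}. d * e \<le> M\<^sup>2}"
        using d by (auto simp: less_eq_div_iff_mult_less_eq mult.commute)
      then show "g d * H (M\<^sup>2 div d) = (\<Sum>e\<in>{e\<in>{1..M}. d * e \<le> M\<^sup>2}. g d * (1 / sqrt (real e)))"
        unfolding H_def sum_distrib_left by simp
    qed auto
    also have "\<dots> = (\<Sum>e\<in>{1..M}. \<Sum>d\<in>{d\<in>{M<..M\<^sup>2}. d * e \<le> M\<^sup>2}. g d * (1 / sqrt (real e)))"
      by (rule sum.swap_restrict) auto
    also have "\<dots> = (\<Sum>e=1..M. (\<Sum>d\<in>{M<..M\<^sup>2 div e}. g d) * (1 / sqrt (real e)))"
    proof (rule sum.cong)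
      fix e assume e: "e \<in> {1..M}"
      have "d \<le> M\<^sup>2" if "d * e \<le> M\<^sup>2" for d
        using that e by (auto intro: order.trans[of _ "d * e"])
      then have "{d\<in>{M<..M\<^sup>2}. d * e \<le> M\<^sup>2} = {M<..M\<^sup>2 div e}"
        using e by (auto simp: less_eq_div_iff_mult_less_eq)
      then show "(\<Sum>d\<in>{d\<in>{M<..M\<^sup>2}. d * e \<le> M\<^sup>2}. g d * (1 / sqrt (real e))) =
          (\<Sum>d\<in>{M<..M\<^sup>2 div e}. g d) * (1 / sqrt (real e))"
        by (simp add: sum_divide_distrib)
    qed auto
    also have "\<dots> \<le> 4 * real k"
    proof -
      have "(\<Sum>e=1..M. (\<Sum>d\<in>{M<..M\<^sup>2 div e}. g d) * (1 / sqrt (real e)))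
        \<le> (\<Sum>e=1..M. 2 * real k * (1 / sqrt (real (Suc M))) * (1 / sqrt (real e)))"
        by (intro sum_mono mult_right_mono) (use X_le[of M] in \<open>auto simp: g_def abs_le_iff\<close>)
      also have "\<dots> = 2 * real k * (1 / sqrt (real (Suc M))) * H M"
        by (simp add: H_def sum_distrib_left)
      also have "\<dots> \<le> 2 * real k * (1 / sqrt (real (Suc M))) * (2 * sqrt (real M))"
        unfolding H_def by (intro mult_left_mono sum_inverse_sqrt_le) auto
      also have "\<dots> = 4 * real k * (sqrt (real M) / sqrt (real (Suc M)))" by simp
      also have "\<dots> \<le> 4 * real k * 1"
        by (intro mult_left_mono) (auto simp: divide_le_eq_1)
      finally show ?thesis by simp
    qed
    \<comment> \<open>The main term 2 sqrt (M^2 / d) of \<open>H\<close> times \<open>g d\<close> is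
      2 M \<chi>(d) / d. Its sum is 2 M times a partial sum of L(1, \<chi>), which is bounded
      exactly because L = 0 leaves an error of order 1 / M.\<close>
    also have "(\<Sum>d=1..M. g d * H (M\<^sup>2 div d)) =
        (\<Sum>d=1..M. g d * (H (M\<^sup>2 div d) - 2 * sqrt (real (M\<^sup>2) / real d) - c))
        + 2 * real M * (\<Sum>d=1..M. \<chi> d * (1 / real d)) + c * (\<Sum>d=1..M. g d)"
    proof -
      have "g d * (2 * sqrt (real (M\<^sup>2) / real d)) = 2 * real M * (\<chi> d * (1 / real d))" if "d \<in> {1..M}" for d
        using that by (simp add: g_def real_sqrt_divide)
      then have "2 * real M * (\<Sum>d=1..M. \<chi> d * (1 / real d)) = (\<Sum>d=1..M. g d * (2 * sqrt (real (M\<^sup>2) / real d)))"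
        unfolding sum_distrib_left by (intro sum.cong) auto
      then show ?thesis
        by (simp add: sum_distrib_left sum.distrib[symmetric] algebra_simps sum_subtractf)
    qed
    also have "(\<Sum>d=1..M. g d * (H (M\<^sup>2 div d) - 2 * sqrt (real (M\<^sup>2) / real d) - c)) \<le> 4"
    proof -
      have "(\<Sum>d=1..M. g d * (H (M\<^sup>2 div d) - 2 * sqrt (real (M\<^sup>2) / real d) - c))
        \<le> (\<Sum>d=1..M. 1 / sqrt (real d) * (2 / sqrt (real M)))"
      proof (rule sum_mono)
        fix d assume d: "d \<in> {1..M}"
        define q where "q = M\<^sup>2 div d"
        have "M * d \<le> M\<^sup>2" using d by (simp add: power2_eq_square)
        then have q: "M \<le> q" using d by (auto simp: q_def less_eq_div_iff_mult_less_eq)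
        have "d \<le> M\<^sup>2" using d \<open>M * d \<le> M\<^sup>2\<close> M by (auto intro: order.trans[of _ "M * d"])
        then have "\<bar>sqrt (real (M\<^sup>2) / real d) - sqrt (real q)\<bar> \<le> 1 / (2 * sqrt (real q))"
          unfolding q_def using d by (intro sqrt_diff_nat_div_le) auto
        moreover have "\<bar>H q - 2 * sqrt (real q) - c\<bar> \<le> 1 / sqrt (real q)"
          using c[of q] q M by simp
        moreover have "1 / (2 * sqrt (real q)) = (1 / sqrt (real q)) / 2" by simp
        ultimately have "\<bar>H q - 2 * sqrt (real (M\<^sup>2) / real d) - c\<bar> \<le> 2 * (1 / sqrt (real q))"
          by linarith
        also have "\<dots> \<le> 2 / sqrt (real M)" using q M by (simp add: frac_le)
        finally have le: "\<bar>H q - 2 * sqrt (real (M\<^sup>2) / real d) - c\<bar> \<le> 2 / sqrt (real M)" .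
        have "\<bar>g d\<bar> \<le> 1 / sqrt (real d)"
          using abs_le_1[of d] by (simp add: g_def abs_mult divide_right_mono)
        then have "\<bar>g d * (H q - 2 * sqrt (real (M\<^sup>2) / real d) - c)\<bar> \<le> 1 / sqrt (real d) * (2 / sqrt (real M))"
          unfolding abs_mult using le by (intro mult_mono) auto
        then show "g d * (H (M\<^sup>2 div d) - 2 * sqrt (real (M\<^sup>2) / real d) - c) \<le> 1 / sqrt (real d) * (2 / sqrt (real M))"
          by (simp add: q_def)
      qed
      also have "\<dots> = H M * (2 / sqrt (real M))" by (simp only: H_def sum_distrib_right)
      also have "\<dots> \<le> 2 * sqrt (real M) * (2 / sqrt (real M))"
        unfolding H_def by (intro mult_right_mono sum_inverse_sqrt_le) auto
      also have "\<dots> = 4" using M by simp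
      finally show ?thesis .
    qed
    also have "2 * real M * (\<Sum>d=1..M. \<chi> d * (1 / real d)) \<le> 4 * real k"
    proof -
      have "2 * real M * (\<Sum>d=1..M. \<chi> d * (1 / real d)) \<le> 2 * real M * (2 * real k * (1 / real (Suc M)))"
        using L[of M] \<open>L = 0\<close> by (intro mult_left_mono) auto
      also have "\<dots> = 4 * real k * (real M / real (Suc M))" by simp
      also have "\<dots> \<le> 4 * real k * 1" by (intro mult_left_mono) auto
      finally show ?thesis by simp
    qed
    also have "c * (\<Sum>d=1..M. g d) \<le> \<bar>c\<bar> * (2 * real k)"
    proof -
      have "{1..M} = {0<..M}" by auto
      then have "\<bar>\<Sum>d=1..M. g d\<bar> \<le> 2 * real k" using X_le[of 0 M] by (simp add: g_def)
      then have "\<bar>c * (\<Sum>d=1..M. g d)\<bar> \<le> \<bar>c\<bar> * (2 * real k)"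
        unfolding abs_mult by (intro mult_left_mono) auto
      then show ?thesis by simp
    qed
    finally show ?thesis by (simp add: B_def)
  qed
  define M where "M = nat \<lceil>exp B\<rceil>"
  have "exp B < real M + 1" unfolding M_def by linarith
  then have "B < ln (real M + 1)" by (subst ln_exp[symmetric], subst ln_less_cancel_iff) auto
  moreover have "M > 0" by (simp add: M_def)
  ultimately show False using upper[of M] by linarith
qed

text \<open>Since ln is the divisor sum of \<open>mangoldt\<close>, the bounded sum of \<chi>(n) ln
  n / n is a double sum whose inner part is a partial sum of L(1, \<chi>). Replacing that part by L
  costs O(d / N), which Chebyshev's bound controls; then L is divided out.\<close>

lemma sum_mangoldt_bounded:
  obtains C where "\<And>N. \<bar>\<Sum>d=1..N. \<chi> d * (mangoldt d / real d)\<bar> \<le> C"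
proof -
  have anti: "1 / real (Suc n) \<le> 1 / real n" if "n > 0" for n
    using that by (simp add: frac_le)
  obtain L where L: "\<And>m. \<bar>(\<Sum>n=1..m. \<chi> n * (1 / real n)) - L\<bar> \<le> 2 * real k * (1 / real (Suc m))"
    using weighted_series_limit[of "\<lambda>n. 1 / real n"] anti lim_1_over_n by auto
  then have L0: "L \<noteq> 0" by (rule series_limit_nonzero)
  have ln_bound: "\<bar>\<Sum>n=1..N. \<chi> n * (ln (real n) / real n)\<bar> \<le> 2 + 2 * real k * 2" for N
  proof -
    \<comment> \<open>ln n / n decreases only from e on, so the terms for n = 1 and n = 2 are
      estimated separately.\<close>
    have anti': "ln (real (Suc n)) / real (Suc n) \<le> ln (real n) / real n" if "n > 2" for n
    proof -
      have "exp 1 \<le> real n" using exp_le that by linarith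
      then have "1 \<le> ln (real n)" using that by (subst ln_ge_iff) auto
      moreover have "ln (real n + 1) - ln (real n) \<le> 1 / real n"
        using ln_diff_le[of "real n + 1" "real n"] that by simp
      then have "real n * (ln (real n + 1) - ln (real n)) \<le> 1"
        using that by (simp add: field_simps)
      ultimately have "real n * ln (real n + 1) \<le> (real n + 1) * ln (real n)"
        by (simp add: algebra_simps)
      then show ?thesis using that by (simp add: field_simps)
    qed
    have le: "\<bar>\<Sum>n\<in>{2<..N}. \<chi> n * (ln (real n) / real n)\<bar> \<le> 2 * real k * 2"
    proof (cases "2 \<le> N")
      case True
      then have "\<bar>\<Sum>n\<in>{2<..N}. \<chi> n * (ln (real n) / real n)\<bar> \<le> 2 * real k * (ln (real 3) / real 3)"
        using abs_weighted_sum_le[of 2 "\<lambda>n. ln (real n) / real n" N] anti' by simp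
      also have "\<dots> \<le> 2 * real k * 2"
        using ln_le_minus_one[of 3] by (intro mult_left_mono) auto
      finally show ?thesis .
    qed auto
    have "(\<Sum>n=1..N. \<chi> n * (ln (real n) / real n)) =
       (\<Sum>n\<in>{1..N} \<inter> {1,2}. \<chi> n * (ln (real n) / real n)) + (\<Sum>n\<in>{2<..N}. \<chi> n * (ln (real n) / real n))"
      by (subst sum.union_disjoint[symmetric]) (auto intro!: sum.cong)
    moreover have "\<bar>\<Sum>n\<in>{1..N} \<inter> {1,2}. \<chi> n * (ln (real n) / real n)\<bar> \<le> 2"
    proof -
      have "\<bar>\<Sum>n\<in>{1..N} \<inter> {1,2}. \<chi> n * (ln (real n) / real n)\<bar> \<le> (\<Sum>n\<in>{1..N} \<inter> {1,2}. 1)"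
      proof (rule order.trans[OF sum_abs sum_mono])
        fix n assume "n \<in> {1..N} \<inter> {1,2}"
        then have n: "n > 0" by auto
        then have "ln (real n) \<le> real n" "ln (real n) \<ge> 0" using ln_le_minus_one[of "real n"] by auto
        then have "\<bar>ln (real n) / real n\<bar> \<le> 1" using n by simp
        then have "\<bar>\<chi> n\<bar> * \<bar>ln (real n) / real n\<bar> \<le> 1 * 1"
          using abs_le_1[of n] by (intro mult_mono) auto
        then show "\<bar>\<chi> n * (ln (real n) / real n)\<bar> \<le> 1" by (simp only: abs_mult)
      qed
      also have "\<dots> \<le> real (card {1, 2::nat})"
        by (simp del: One_nat_def card_insert_disjoint) (rule card_mono, auto)
      finally show ?thesis by simp
    qed
    ultimately show ?thesis using le by linarith
  qed
  have "\<bar>\<Sum>d=1..N. \<chi> d * (mangoldt d / real d)\<bar> \<le> (2 + 2 * real k * 2 + 8 * real k) / \<bar>L\<bar>" for N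
  proof (cases "N = 0")
    case False
    define P where "P m = (\<Sum>n=1..m. \<chi> n * (1 / real n))" for m
    define S where "S = (\<Sum>d=1..N. \<chi> d * (mangoldt d / real d))"
    have "(\<Sum>n=1..N. \<chi> n * (ln (real n) / real n)) =
      (\<Sum>n=1..N. \<Sum>d | d dvd n. \<chi> d * (mangoldt d / real d) * (\<chi> (n div d) * (1 / real (n div d))))"
    proof (rule sum.cong)
      fix n assume n: "n \<in> {1..N}"
      have "\<chi> n * (ln (real n) / real n) = (\<Sum>d | d dvd n. \<chi> n * mangoldt d / real n)"
        using n mangoldt_sum[of n, where 'a = real] by (simp flip: sum_divide_distrib sum_distrib_left)
      also have "\<dots> = (\<Sum>d | d dvd n. \<chi> d * (mangoldt d / real d) * (\<chi> (n div d) * (1 / real (n div d))))"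
      proof (rule sum.cong)
        fix d assume "d \<in> {d. d dvd n}"
        then obtain e where e: "n = d * e" by auto
        then have "d > 0" "e > 0" using n by (auto intro: Nat.gr0I)
        then show "\<chi> n * mangoldt d / real n = \<chi> d * (mangoldt d / real d) * (\<chi> (n div d) * (1 / real (n div d)))"
          by (simp add: e mult)
      qed auto
      finally show "\<chi> n * (ln (real n) / real n) =
        (\<Sum>d | d dvd n. \<chi> d * (mangoldt d / real d) * (\<chi> (n div d) * (1 / real (n div d))))" .
    qed auto
    also have "\<dots> = (\<Sum>d=1..N. \<chi> d * (mangoldt d / real d) * P (N div d))"
      unfolding P_def sum_distrib_left by (rule sum_divisors_swap)
    also have "\<dots> = L * S + (\<Sum>d=1..N. \<chi> d * (mangoldt d / real d) * (P (N div d) - L))"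
      unfolding S_def sum_distrib_left sum.distrib[symmetric] by (intro sum.cong) (simp_all add: algebra_simps diff_divide_distrib)
    finally have eq: "L * S = (\<Sum>n=1..N. \<chi> n * (ln (real n) / real n))
        - (\<Sum>d=1..N. \<chi> d * (mangoldt d / real d) * (P (N div d) - L))" by simp
    have "\<bar>\<Sum>d=1..N. \<chi> d * (mangoldt d / real d) * (P (N div d) - L)\<bar> \<le> (\<Sum>d=1..N. mangoldt d * (2 * real k / real N))"
    proof (rule order.trans[OF sum_abs sum_mono])
      fix d assume d: "d \<in> {1..N}"
      have "N < Suc (N div d) * d" using d by (simp add: dividend_less_div_times)
      then have "real N \<le> real (Suc (N div d)) * real d" by (metis less_imp_le of_nat_le_iff of_nat_mult)
      then have "1 / real (Suc (N div d)) \<le> real d / real N"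
        using d by (simp add: field_simps del: of_nat_Suc)
      then have "2 * real k * (1 / real (Suc (N div d))) \<le> 2 * real k * (real d / real N)"
        by (intro mult_left_mono) auto
      then have PL: "\<bar>P (N div d) - L\<bar> \<le> 2 * real k * (real d / real N)"
        using L[of "N div d"] unfolding P_def by linarith
      have "\<bar>\<chi> d * (mangoldt d / real d)\<bar> \<le> mangoldt d / real d"
        using abs_le_1[of d] mult_right_mono[of "\<bar>\<chi> d\<bar>" 1 "mangoldt d / real d"]
        by (simp add: abs_mult mangoldt_nonneg)
      then have "\<bar>\<chi> d * (mangoldt d / real d) * (P (N div d) - L)\<bar>
          \<le> mangoldt d / real d * (2 * real k * (real d / real N))"
        unfolding abs_mult[of "\<chi> d * (mangoldt d / real d)"] using PL
        by (intro mult_mono) (auto simp: mangoldt_nonneg)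
      also have "\<dots> = mangoldt d * (2 * real k / real N)" using d by simp
      finally show "\<bar>\<chi> d * (mangoldt d / real d) * (P (N div d) - L)\<bar> \<le> mangoldt d * (2 * real k / real N)" .
    qed
    also have "\<dots> = (\<Sum>d=1..N. mangoldt d) * (2 * real k / real N)"
      by (simp only: sum_distrib_right)
    also have "\<dots> \<le> 4 * real N * (2 * real k / real N)"
      by (intro mult_right_mono sum_mangoldt_le) auto
    also have "\<dots> = 8 * real k" using False by simp
    finally have "\<bar>L * S\<bar> \<le> 2 + 2 * real k * 2 + 8 * real k"
      unfolding eq using ln_bound[of N] by linarith
    then show ?thesis using L0 by (simp add: S_def abs_mult field_simps)
  qed simp
  then show ?thesis using that by blast
qed

end

section \<open>Primes with prescribed quadratic symbols\<close>

text \<open>Each term is at most 2 (1 / sqrt (n - 1) - 1 / sqrt n), so the sum telescopes.\<close>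

lemma sum_three_halves_le: "(\<Sum>n=2..N. 1 / (real n * sqrt (real n))) \<le> 2"
proof -
  have step: "1 / (real n * sqrt (real n)) \<le> 2 * (1 / sqrt (real (n - 1)) - 1 / sqrt (real n))"
    if "n \<ge> 2" for n
  proof -
    define s t where "s = sqrt (real (n - 1))" and "t = sqrt (real n)"
    have st: "s > 0" "s \<le> t" using that by (auto simp: s_def t_def)
    have "(t - s) * (t + s) = 1" using that by (simp add: s_def t_def algebra_simps of_nat_diff)
    moreover have "(t - s) * (t + s) \<le> (t - s) * (2 * t)" using st by (intro mult_left_mono) auto
    ultimately have "1 / (2 * t) \<le> t - s" using st by (simp add: field_simps)
    then have "1 / (2 * t) * (1 / (t * t)) \<le> (t - s) * (1 / (t * s))"
      using st by (intro mult_mono frac_le) auto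
    also have "\<dots> = 1 / s - 1 / t" using st by (simp add: field_simps)
    finally have "1 / (t * t * t) \<le> 2 * (1 / s - 1 / t)" by simp
    then show ?thesis by (simp add: s_def t_def)
  qed
  have "(\<Sum>n=2..N. 1 / (real n * sqrt (real n))) \<le> 2 - 2 / sqrt (real N)" if "N \<ge> 1"
    using that
  proof (induction N rule: nat_induct_at_least)
    case (Suc n)
    then show ?case using step[of "Suc n"] by simp
  qed simp
  then show ?thesis by (cases "N = 0") (auto intro: order.trans)
qed

text \<open>Only proper prime powers contribute. For each p the geometric series over exponents from
  2 on is at most 2 / p^2, and ln p \<le> 2 sqrt p leaves a convergent sum of 4 / p^(3/2).\<close>

lemma sum_mangoldt_nonprime_le:
  "(\<Sum>d\<in>{d\<in>{1..N}. \<not> prime d}. mangoldt d / real d) \<le> 8"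
proof -
  define A where "A = {p\<in>{2..N}. prime p} \<times> {2..N}"
  have "(\<Sum>d\<in>{d\<in>{1..N}. \<not> prime d}. mangoldt d / real d)
      = (\<Sum>d\<in>{d\<in>{1..N}. \<not> prime d \<and> primepow d}. mangoldt d / real d)"
    by (rule sum.mono_neutral_right) (auto simp: mangoldt_def)
  also have "\<dots> \<le> (\<Sum>d\<in>(\<lambda>(p, j). p ^ j) ` A. mangoldt d / real d)"
  proof (rule sum_mono2)
    show "{d\<in>{1..N}. \<not> prime d \<and> primepow d} \<subseteq> (\<lambda>(p, j). p ^ j) ` A"
    proof
      fix d assume d: "d \<in> {d\<in>{1..N}. \<not> prime d \<and> primepow d}"
      then obtain p j where pj: "prime p" "j > 0" "d = p ^ j" by (auto simp: primepow_def)
      then have "j \<noteq> 1" using d by auto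
      have "p \<le> p ^ j" using pj by (intro self_le_power) (auto simp: prime_gt_0_nat Suc_leI)
      moreover have "j < p ^ j" using pj prime_gt_1_nat by (intro power_gt_expt) auto
      ultimately have "(p, j) \<in> A"
        using d pj \<open>j \<noteq> 1\<close> prime_ge_2_nat[of p] by (auto simp: A_def)
      then show "d \<in> (\<lambda>(p, j). p ^ j) ` A" using pj(3) by force
    qed
  qed (auto simp: A_def mangoldt_nonneg)
  also have "\<dots> \<le> (\<Sum>(p, j)\<in>A. ln (real p) / real p ^ j)"
    by (rule order.trans[OF sum_image_le], force simp: A_def, force simp: mangoldt_nonneg)
       (auto simp: A_def o_def case_prod_unfold intro!: sum_mono)
  also have "\<dots> = (\<Sum>p\<in>{p\<in>{2..N}. prime p}. \<Sum>j=2..N. ln (real p) / real p ^ j)"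
    unfolding A_def by (rule sum.cartesian_product[symmetric])
  also have "\<dots> \<le> (\<Sum>p\<in>{p\<in>{2..N}. prime p}. 4 * (1 / (real p * sqrt (real p))))"
  proof (rule sum_mono)
    fix p assume "p \<in> {p\<in>{2..N}. prime p}"
    then have p: "p \<ge> 2" by auto
    have geom: "(\<Sum>j=2..n. 1 / real p ^ j) \<le> 2 / real p ^ 2 - 1 / real p ^ n" if "n \<ge> 2" for n
      using that
    proof (induction n rule: nat_induct_at_least)
      case base
      show ?case by simp
    next
      case (Suc n)
      have "2 * (1 / real p ^ Suc n) \<le> 1 / real p ^ n" using p by (simp add: field_simps)
      then show ?case using Suc by simp
    qed
    have "(\<Sum>j=2..N. 1 / real p ^ j) \<le> 2 / real p ^ 2"
    proof (cases "N \<ge> 2")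
      case True
      then show ?thesis using geom[of N] p by (auto intro: order.trans)
    qed simp
    moreover have "ln (real p) \<le> 2 * sqrt (real p)"
    proof -
      have "ln (real p) = 2 * ln (sqrt (real p))" using p by (simp add: ln_sqrt)
      then show ?thesis using ln_le_minus_one[of "sqrt (real p)"] p by simp
    qed
    ultimately have "ln (real p) * (\<Sum>j=2..N. 1 / real p ^ j) \<le> 2 * sqrt (real p) * (2 / real p ^ 2)"
      by (intro mult_mono) (auto intro: sum_nonneg)
    also have "\<dots> = 4 * (1 / (real p * sqrt (real p)))"
      using p by (simp add: field_simps power2_eq_square)
    finally show "(\<Sum>j=2..N. ln (real p) / real p ^ j) \<le> 4 * (1 / (real p * sqrt (real p)))"
      by (simp add: sum_distrib_left)
  qed
  also have "\<dots> \<le> (\<Sum>p=2..N. 4 * (1 / (real p * sqrt (real p))))"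
    by (intro sum_mono2) auto
  also have "\<dots> \<le> 4 * 2"
    unfolding sum_distrib_left[symmetric] by (intro mult_left_mono sum_three_halves_le) auto
  finally show ?thesis by simp
qed

text \<open>Multiplication by a unit permutes the residues; this makes the sum of a nonprincipal
  character over a period vanish.\<close>

lemma sum_mod_mult_coprime:
  fixes f :: "nat \<Rightarrow> 'a::comm_monoid_add"
  assumes "coprime u k" "k > 0"
  shows "(\<Sum>n<k. f (u * n mod k)) = (\<Sum>n<k. f n)"
proof -
  have inj: "inj_on (\<lambda>n. u * n mod k) {..<k}"
  proof (rule inj_onI)
    fix x y assume xy: "x \<in> {..<k}" "y \<in> {..<k}" "u * x mod k = u * y mod k"
    then have "[u * x = u * y] (mod k)" by (simp add: cong_def)
    then have "[x = y] (mod k)" using assms(1) by (simp add: cong_mult_lcancel_nat)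
    then show "x = y" using xy by (simp add: cong_def)
  qed
  have "(\<lambda>n. u * n mod k) ` {..<k} = {..<k}"
    using assms(2) by (intro endo_inj_surj inj) auto
  then show ?thesis using sum.reindex[OF inj, of f] by (simp add: o_def)
qed

text \<open>If no such prime existed, the product of the factors 1 + \<epsilon> i * \<chi> i d would
  vanish at every prime d coprime to k. Expanded over subsets of I and summed against mangoldt d /
  d, it has a principal part growing like ln N and otherwise bounded parts, while nonprimes
  contribute only a bounded amount.\<close>

theorem prime_with_prescribed_real_characters:
  fixes \<chi> :: "'i \<Rightarrow> nat \<Rightarrow> real"
  assumes "finite I" "k > 0"
    and mult: "\<And>i a b. i \<in> I \<Longrightarrow> \<chi> i (a * b) = \<chi> i a * \<chi> i b"
    and one: "\<And>i. i \<in> I \<Longrightarrow> \<chi> i 1 = 1"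
    and periodic: "\<And>i n. i \<in> I \<Longrightarrow> \<chi> i (n + k) = \<chi> i n"
    and sign: "\<And>i n. i \<in> I \<Longrightarrow> coprime n k \<Longrightarrow> \<chi> i n \<in> {-1, 1}"
    and indep: "\<And>i. i \<in> I \<Longrightarrow> \<exists>n. coprime n k \<and> \<chi> i n = -1 \<and> (\<forall>j\<in>I - {i}. \<chi> j n = 1)"
    and \<epsilon>: "\<And>i. i \<in> I \<Longrightarrow> \<epsilon> i \<in> {-1, 1}"
  shows "\<exists>p. prime p \<and> coprime p k \<and> (\<forall>i\<in>I. \<chi> i p = \<epsilon> i)"
proof (rule ccontr)
  assume "\<not> ?thesis"
  then have none: "\<exists>i\<in>I. \<chi> i p \<noteq> \<epsilon> i" if "prime p" "coprime p k" for p
    using that by blast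
  \<comment> \<open>The empty set gives the principal character. For nonempty \<open>S\<close> the
    hypothesis \<open>indep\<close> supplies a unit with value -1, so the product is
    nonprincipal.\<close>
  define X where "X S n = (if coprime n k then \<Prod>i\<in>S. \<chi> i n else 0)" for S n
  have char: "real_character k (X S)" if S: "S \<subseteq> I" "S \<noteq> {}" for S
  proof -
    have X_mult: "X S (a * b) = X S a * X S b" for a b
      using S by (auto simp: X_def mult prod.distrib[symmetric] subset_iff intro!: prod.cong)
    have X_periodic: "X S (n + k) = X S n" for n
    proof -
      have "coprime (n + k) k \<longleftrightarrow> coprime n k" by (simp only: coprime_iff_gcd_eq_1 gcd_add1)
      moreover have "(\<Prod>i\<in>S. \<chi> i (n + k)) = (\<Prod>i\<in>S. \<chi> i n)"
        using S periodic by (intro prod.cong) auto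
      ultimately show ?thesis by (simp add: X_def)
    qed
    have X_mod: "X S (n mod k) = X S n" for n
    proof -
      have "X S (r + q * k) = X S r" for r q
      proof (induction q)
        case (Suc q)
        then show ?case using X_periodic[of "r + q * k"] by (simp add: algebra_simps)
      qed simp
      from this[of "n mod k" "n div k"] show ?thesis by simp
    qed
    obtain i where i: "i \<in> S" using S by blast
    then obtain u where u: "coprime u k" "\<chi> i u = -1" "\<forall>j\<in>I - {i}. \<chi> j u = 1"
      using indep S by blast
    have "X S u = -1"
    proof -
      have "finite S" using S \<open>finite I\<close> finite_subset by blast
      then have "(\<Prod>j\<in>S. \<chi> j u) = \<chi> i u * (\<Prod>j\<in>S - {i}. \<chi> j u)" using i by (rule prod.remove)
      also have "(\<Prod>j\<in>S - {i}. \<chi> j u) = 1" using u S by (intro prod.neutral) auto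
      finally show ?thesis using u by (simp add: X_def)
    qed
    then have "(\<Sum>n<k. X S n) = - (\<Sum>n<k. X S n)"
      using sum_mod_mult_coprime[OF u(1) \<open>k > 0\<close>, of "X S"] by (simp add: X_mod X_mult sum_negf)
    then have X_sum: "(\<Sum>n<k. X S n) = 0" by simp
    have X_values: "X S n \<in> {-1, 0, 1}" for n
    proof (cases "coprime n k")
      case True
      have "finite S" using S \<open>finite I\<close> finite_subset by blast
      then have "(\<Prod>i\<in>S. \<chi> i n) \<in> {-1, 1}"
        using S(1)
      proof (induction S rule: finite_induct)
        case (insert j F)
        then have "\<chi> j n \<in> {-1, 1}" using sign True by auto
        then show ?case using insert by auto
      qed simp
      then show ?thesis using True by (auto simp: X_def)
    qed (simp add: X_def)
    have X_one: "X S 1 = 1" using S one by (auto simp: X_def subset_iff intro: prod.neutral)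
    show ?thesis
      by unfold_locales (use \<open>k > 0\<close> X_mult X_one X_values X_periodic X_sum in auto)
  qed
  have "\<exists>C. \<forall>N. \<bar>\<Sum>d=1..N. X S d * (mangoldt d / real d)\<bar> \<le> C" if "S \<subseteq> I" "S \<noteq> {}" for S
    using real_character.sum_mangoldt_bounded[OF char[OF that]] by metis
  then obtain C where C: "\<And>S N. S \<subseteq> I \<Longrightarrow> S \<noteq> {} \<Longrightarrow> \<bar>\<Sum>d=1..N. X S d * (mangoldt d / real d)\<bar> \<le> C S"
    by metis
  define K where "K = (\<Sum>d=1..k. mangoldt d / real d :: real)"
  \<comment> \<open>In order: nonprimes in the sum of the product, the nonprincipal parts, the
    primes dividing \<open>k\<close>, and the nonprimes that the principal character may
    miss.\<close>
  define B where "B = 2 ^ card I * 8 + (\<Sum>S\<in>Pow I - {{}}. C S) + K + 8"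
  have bound: "ln (real N) - 1 \<le> B" if "N > 0" for N
  proof -
    define w where "w d = mangoldt d / real d" for d
    have w: "w d \<ge> 0" for d by (simp add: w_def mangoldt_nonneg)
    define G where "G d = (\<Prod>i\<in>I. 1 + \<epsilon> i * \<chi> i d)" for d
    have G_expand: "(if coprime d k then G d else 0) = (\<Sum>S\<in>Pow I. (\<Prod>i\<in>S. \<epsilon> i) * X S d)" for d
    proof (cases "coprime d k")
      case True
      have "G d = (\<Prod>i\<in>I. \<epsilon> i * \<chi> i d + 1)" by (simp add: G_def add.commute)
      also have "\<dots> = (\<Sum>S\<in>Pow I. (\<Prod>i\<in>S. \<epsilon> i * \<chi> i d) * (\<Prod>i\<in>I - S. 1))"
        using \<open>finite I\<close> by (rule prod_add)
      finally show ?thesis using True by (simp add: X_def prod.distrib)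
    qed (simp add: X_def)
    define T where "T = (\<Sum>d=1..N. (if coprime d k then G d else 0) * w d)"
    have "T = (\<Sum>d=1..N. \<Sum>S\<in>Pow I. (\<Prod>i\<in>S. \<epsilon> i) * (X S d * w d))"
      unfolding T_def G_expand by (simp add: sum_distrib_right mult.assoc)
    also have "\<dots> = (\<Sum>S\<in>Pow I. (\<Prod>i\<in>S. \<epsilon> i) * (\<Sum>d=1..N. X S d * w d))"
      by (subst sum.swap) (simp add: sum_distrib_left)
    also have "\<dots> = (\<Sum>d=1..N. X {} d * w d) + (\<Sum>S\<in>Pow I - {{}}. (\<Prod>i\<in>S. \<epsilon> i) * (\<Sum>d=1..N. X S d * w d))"
      using \<open>finite I\<close> by (subst sum.remove[of _ "{}"]) auto
    finally have T_eq: "T = (\<Sum>d=1..N. X {} d * w d)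
      + (\<Sum>S\<in>Pow I - {{}}. (\<Prod>i\<in>S. \<epsilon> i) * (\<Sum>d=1..N. X S d * w d))" .
    have rest: "\<bar>\<Sum>S\<in>Pow I - {{}}. (\<Prod>i\<in>S. \<epsilon> i) * (\<Sum>d=1..N. X S d * w d)\<bar> \<le> (\<Sum>S\<in>Pow I - {{}}. C S)"
    proof (rule order.trans[OF sum_abs sum_mono])
      fix S assume S: "S \<in> Pow I - {{}}"
      have "\<bar>\<Prod>i\<in>S. \<epsilon> i\<bar> = (\<Prod>i\<in>S. 1)"
        unfolding abs_prod using S \<epsilon> by (intro prod.cong) force+
      then show "\<bar>(\<Prod>i\<in>S. \<epsilon> i) * (\<Sum>d=1..N. X S d * w d)\<bar> \<le> C S"
        using C[of S N] S by (simp add: abs_mult w_def)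
    qed
    have "\<bar>T\<bar> \<le> (\<Sum>d=1..N. (if prime d then 0 else 2 ^ card I * w d))"
      unfolding T_def
    proof (rule order.trans[OF sum_abs sum_mono])
      fix d assume "d \<in> {1..N}"
      show "\<bar>(if coprime d k then G d else 0) * w d\<bar> \<le> (if prime d then 0 else 2 ^ card I * w d)"
      proof (cases "coprime d k")
        case cop: True
        show ?thesis
        proof (cases "prime d")
          case True
          then obtain i where i: "i \<in> I" "\<chi> i d \<noteq> \<epsilon> i" using none cop by blast
          then have "1 + \<epsilon> i * \<chi> i d = 0" using sign[of i d] \<epsilon>[of i] cop by auto
          then have "G d = 0" using i(1) \<open>finite I\<close> by (auto simp: G_def prod_zero_iff)
          then show ?thesis using True by simp
        next
          case False
          have "\<bar>G d\<bar> \<le> (\<Prod>i\<in>I. 2)"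
            unfolding G_def abs_prod
          proof (rule prod_mono)
            fix i assume "i \<in> I"
            then show "0 \<le> \<bar>1 + \<epsilon> i * \<chi> i d\<bar> \<and> \<bar>1 + \<epsilon> i * \<chi> i d\<bar> \<le> 2"
              using sign[of i d] \<epsilon>[of i] cop by auto
          qed
          then show ?thesis using False cop w[of d] by (simp add: abs_mult mult_right_mono)
        qed
      qed (use w in auto)
    qed
    also have "\<dots> = 2 ^ card I * (\<Sum>d\<in>{d\<in>{1..N}. \<not> prime d}. w d)"
      unfolding sum_distrib_left by (rule sum.mono_neutral_cong_right) auto
    also have "\<dots> \<le> 2 ^ card I * 8"
      unfolding w_def by (intro mult_left_mono sum_mangoldt_nonprime_le) auto
    finally have T_le: "\<bar>T\<bar> \<le> 2 ^ card I * 8" .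
    \<comment> \<open>The principal character misses only d not coprime to k: such a d is either not
      prime, or a prime dividing k and hence at most k.\<close>
    have "(\<Sum>d=1..N. w d) \<le> (\<Sum>d=1..N. X {} d * w d)
        + ((\<Sum>d=1..k. w d) + (\<Sum>d\<in>{d\<in>{1..N}. \<not> prime d}. w d))"
    proof -
      have "(\<Sum>d=1..N. w d) \<le> (\<Sum>d=1..N. X {} d * w d
        + ((if d \<le> k then w d else 0) + (if \<not> prime d then w d else 0)))"
      proof (rule sum_mono)
        fix d assume "d \<in> {1..N}"
        have "d \<le> k" if "prime d" "\<not> coprime d k"
          using that \<open>k > 0\<close> prime_imp_coprime[of d k] dvd_imp_le by blast
        then show "w d \<le> X {} d * w d + ((if d \<le> k then w d else 0) + (if \<not> prime d then w d else 0))"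
          using w[of d] by (auto simp: X_def)
      qed
      also have "\<dots> = (\<Sum>d=1..N. X {} d * w d) + ((\<Sum>d\<in>{d\<in>{1..N}. d \<le> k}. w d) + (\<Sum>d\<in>{d\<in>{1..N}. \<not> prime d}. w d))"
        by (simp only: sum.distrib sum.inter_filter finite_atLeastAtMost)
      also have "(\<Sum>d\<in>{d\<in>{1..N}. d \<le> k}. w d) \<le> (\<Sum>d=1..k. w d)"
        using w by (intro sum_mono2) auto
      finally show ?thesis by simp
    qed
    moreover have "(\<Sum>d\<in>{d\<in>{1..N}. \<not> prime d}. w d) \<le> 8"
      unfolding w_def by (rule sum_mangoldt_nonprime_le)
    moreover have "ln (real N) - 1 \<le> (\<Sum>d=1..N. w d)"
      unfolding w_def using that by (rule sum_mangoldt_div_ge)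
    moreover have "K = (\<Sum>d=1..k. w d)" by (simp add: K_def w_def)
    ultimately show ?thesis using T_eq T_le rest unfolding B_def by linarith
  qed
  define N where "N = nat \<lceil>exp (B + 2)\<rceil>"
  have "N > 0" by (simp add: N_def)
  moreover have "exp (B + 2) \<le> real N" unfolding N_def by linarith
  then have "B + 2 \<le> ln (real N)" using \<open>N > 0\<close> by (subst ln_ge_iff) auto
  ultimately show False using bound[of N] by linarith
qed

section \<open>Legendre symbols and the auxiliary prime\<close>

lemma Legendre_cong: "[a = b] (mod p) \<Longrightarrow> Legendre a p = Legendre b p"
  by (simp add: Legendre_def QuadRes_def cong_def)

lemma Legendre_values: "Legendre a p \<in> {-1, 0, 1}"
  by (simp add: Legendre_def)

text \<open>By Euler's criterion the two values agree modulo p, and they differ by at most 2 <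
  p.\<close>

lemma Legendre_eqI:
  assumes "prime p" "2 < p" "[a ^ ((p - 1) div 2) = x] (mod int p)" "x \<in> {-1, 0, 1}"
  shows "Legendre a (int p) = x"
proof -
  have "[Legendre a (int p) = x] (mod int p)"
    using euler_criterion[OF assms(1,2), of a] assms(3) by (metis cong_trans)
  then have "int p dvd Legendre a (int p) - x" by (simp add: cong_iff_dvd_diff)
  moreover have "\<bar>Legendre a (int p) - x\<bar> \<le> 2" using Legendre_values[of a "int p"] assms(4) by auto
  ultimately show ?thesis using assms(2) dvd_imp_le_int[of "Legendre a (int p) - x" "int p"] by force
qed

lemma Legendre_mult:
  assumes "prime p" "2 < p"
  shows "Legendre (a * b) (int p) = Legendre a (int p) * Legendre b (int p)"
proof (rule Legendre_eqI[OF assms])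
  show "[(a * b) ^ ((p - 1) div 2) = Legendre a (int p) * Legendre b (int p)] (mod int p)"
    unfolding power_mult_distrib
    using euler_criterion[OF assms] by (intro cong_mult) (auto intro: cong_sym)
  show "Legendre a (int p) * Legendre b (int p) \<in> {-1, 0, 1}"
    using Legendre_values[of a "int p"] Legendre_values[of b "int p"] by auto
qed

lemma Legendre_one: "prime p \<Longrightarrow> 2 < p \<Longrightarrow> Legendre 1 (int p) = 1"
  by (rule Legendre_eqI) auto

lemma Legendre_minus_one: "prime p \<Longrightarrow> 2 < p \<Longrightarrow> Legendre (-1) (int p) = (-1) ^ ((p - 1) div 2)"
  by (rule Legendre_eqI) (auto simp: minus_one_power_iff)

lemma Legendre_eq_0_iff: "Legendre a p = 0 \<longleftrightarrow> p dvd a"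
  by (simp add: Legendre_def cong_0_iff)

lemma Legendre_eq_1_imp_QuadRes: "Legendre a p = 1 \<Longrightarrow> \<exists>y. [y\<^sup>2 = a] (mod p)"
  by (auto simp: Legendre_def QuadRes_def split: if_splits)

text \<open>Otherwise squaring would be surjective on the residues, hence injective, although p - 1
  and 1 have the same square.\<close>

lemma exists_quadratic_nonresidue:
  assumes "prime p" "2 < p"
  shows "\<exists>u::nat. Legendre (int u) (int p) = -1"
proof (rule ccontr)
  assume no: "\<not> ?thesis"
  define g where "g x = x\<^sup>2 mod p" for x :: nat
  have "{..<p} \<subseteq> g ` {..<p}"
  proof
    fix u assume u: "u \<in> {..<p}"
    show "u \<in> g ` {..<p}"
    proof (cases "u = 0")
      case True
      then show ?thesis using u by (auto simp: g_def intro: image_eqI[of _ _ 0])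
    next
      case False
      then have "\<not> int p dvd int u" using u by (auto dest: nat_dvd_not_less)
      then have "Legendre (int u) (int p) = 1"
        using Legendre_values[of "int u" "int p"] Legendre_eq_0_iff[of "int u" "int p"] no by auto
      then obtain y where "[y\<^sup>2 = int u] (mod int p)" using Legendre_eq_1_imp_QuadRes by blast
      then have "(y mod int p)\<^sup>2 mod int p = int u" using u by (simp add: cong_def power_mod)
      moreover define v where "v = nat (y mod int p)"
      then have v: "y mod int p = int v" "v < p" using assms by (auto simp: nat_less_iff)
      ultimately have "u = g v" unfolding g_def by (metis of_nat_eq_iff of_nat_mod of_nat_power)
      then show ?thesis using v by blast
    qed
  qed
  moreover have "g ` {..<p} \<subseteq> {..<p}" using assms(2) by (auto simp: g_def)
  ultimately have "g ` {..<p} = {..<p}" by blast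
  then have "inj_on g {..<p}" by (intro eq_card_imp_inj_on) simp_all
  moreover have "g (p - 1) = g 1"
  proof -
    obtain r where "p = r + 2" using assms(2) by (metis add.commute le_add_diff_inverse less_imp_le)
    then have "(p - 1)\<^sup>2 = 1 + p * (p - 2)" by (simp add: power2_eq_square)
    then have "g (p - 1) = (1 + p * (p - 2)) mod p" by (simp only: g_def)
    then show ?thesis by (simp only: g_def mod_mult_self2 power_one)
  qed
  ultimately have "p - 1 = 1"
    using assms(2) by (intro inj_onD[of g "{..<p}" "p - 1" 1]) auto
  then show False using assms(2) by simp
qed

text \<open>Gauss's lemma for q = 8 t + 3: the doubles of 1, ..., 4 t + 1 need no reduction, and
  those exceeding 4 t + 1 come from 2 t + 1, ..., 4 t + 1, an odd number of them.\<close>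

lemma Legendre_two_mod_8_eq_3:
  assumes "prime q" "q mod 8 = 3"
  shows "Legendre 2 (int q) = -1"
proof -
  have "q > 2" using assms(2) by (rule_tac ccontr) simp
  have "\<not> int q dvd 2" using \<open>q > 2\<close> by (auto dest!: zdvd_imp_le)
  then have "GAUSS q 2"
    using assms(1) \<open>q > 2\<close> by (intro GAUSS.intro) (simp_all only: cong_0_iff zero_less_numeral not_False_eq_True)
  then interpret GAUSS q 2 .
  obtain t where t: "q = 8 * t + 3" using assms(2) by (metis mult.commute div_mult_mod_eq)
  have "E = (\<lambda>x. x * 2) ` {2 * int t + 1 .. 4 * int t + 1}"
  proof -
    have half: "(int q - 1) div 2 = 4 * int t + 1" using t by simp
    have "(x * 2) mod int q = x * 2" if "x \<in> A" for x
      using that t unfolding A_def half by (intro mod_pos_pos_trivial) auto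
    then have "C = (\<lambda>x. x * 2) ` A" unfolding C_def B_def image_image by (intro image_cong) auto
    then show ?thesis unfolding E_def half A_def by (auto simp: image_iff) presburger?
  qed
  then have "card E = 2 * t + 1" by (simp add: card_image inj_on_def)
  then show ?thesis using gauss_lemma by simp
qed

lemma coprime_nat_primeI:
  fixes a b :: nat
  assumes "\<And>p. prime p \<Longrightarrow> p dvd a \<Longrightarrow> p dvd b \<Longrightarrow> False"
  shows "coprime a b"
proof (rule ccontr)
  assume "\<not> coprime a b"
  then have "gcd a b \<noteq> 1" by (simp only: coprime_iff_gcd_eq_1 not_False_eq_True)
  then obtain p where p: "prime p" "p dvd gcd a b" using prime_factor_nat by blast
  then show False using assms[OF p(1)] by simp
qed

text \<open>The class 3 modulo 8 and the symbols at the odd primes dividing m are sign conditions on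
  characters of period 8 m; the Chinese remainder theorem makes them independent, as
  \<open>prime_with_prescribed_real_characters\<close> requires.\<close>

lemma prime_with_prescribed_Legendre_symbols:
  fixes m :: nat and \<epsilon> :: "nat \<Rightarrow> int"
  assumes "m > 0" and \<epsilon>: "\<And>p. prime p \<Longrightarrow> odd p \<Longrightarrow> p dvd m \<Longrightarrow> \<epsilon> p \<in> {-1, 1}"
  shows "\<exists>q. prime q \<and> q mod 8 = 3 \<and> coprime q m \<and>
    (\<forall>p. prime p \<and> odd p \<and> p dvd m \<longrightarrow> Legendre (int q) (int p) = \<epsilon> p)"
proof -
  define A where "A = {p. prime p \<and> odd p \<and> p dvd m}"
  have "finite A" unfolding A_def using \<open>m > 0\<close> by (intro finite_subset[OF _ finite_divisors_nat[of m]]) auto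
  have A: "prime p" "p > 2" "p dvd m" "odd p" if "p \<in> A" for p
    using that prime_ge_2_nat[of p] by (auto simp: A_def intro: le_neq_implies_less)
  have crt: "\<exists>n. [n = v] (mod 8) \<and> (\<forall>p\<in>A. [n = w p] (mod p))" for v :: nat and w :: "nat \<Rightarrow> nat"
  proof -
    have "coprime i j" if "i \<in> insert 8 A" "j \<in> insert 8 A" "i \<noteq> j" for i j
    proof -
      have "coprime 8 p" if "p \<in> A" for p
        using A(4)[OF that] coprime_power_left_iff[of 2 3 p] by simp
      then show ?thesis using that A(1) primes_coprime[of i j] by (auto simp: coprime_commute)
    qed
    then have "\<exists>x. \<forall>i\<in>insert 8 A. [x = (if i = 8 then v else w i)] (mod i)"
      using \<open>finite A\<close> by (intro chinese_remainder_nat) auto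
    then obtain x where x: "\<And>i. i \<in> insert 8 A \<Longrightarrow> [x = (if i = 8 then v else w i)] (mod i)"
      by blast
    have "8 \<notin> A" by (auto simp: A_def)
    then have "[x = w p] (mod p)" if "p \<in> A" for p using x[of p] that by (auto split: if_splits)
    then show ?thesis using x[of 8] by auto
  qed
  have coprimeI: "coprime n (8 * m)" if "odd n" "\<And>p. p \<in> A \<Longrightarrow> \<not> p dvd n" for n
  proof (rule coprime_nat_primeI)
    fix r assume r: "prime r" "r dvd n" "r dvd 8 * m"
    have "odd r" using r(2) \<open>odd n\<close> by (meson dvd_trans)
    then have "r \<noteq> 2" by auto
    then have "\<not> r dvd 8"
      using r(1) prime_dvd_power[of r 2 3] primes_dvd_imp_eq[of r 2] by auto
    then have "r \<in> A" using r \<open>odd r\<close> by (auto simp: A_def prime_dvd_mult_iff)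
    then show False using that(2) r(2) by blast
  qed
  \<comment> \<open>Index 0 stands for (-1/n) and index 1 for (2/n); these numbers are free because
    \<open>A\<close> consists of odd primes. Prescribing -1 for both singles out 3 modulo 8.\<close>
  define \<chi> where "\<chi> i n = (if i = 0 then (if n mod 4 = 1 then 1 else if n mod 4 = 3 then -1 else 0)
    else if i = 1 then (if n mod 8 \<in> {1, 7} then 1 else if n mod 8 \<in> {3, 5} then -1 else 0)
    else real_of_int (Legendre (int n) (int i)))" for i n :: nat
  have \<chi>0: "\<chi> 0 n = (if n mod 4 = 1 then 1 else if n mod 4 = 3 then -1 else 0)" for n by (simp add: \<chi>_def)
  have \<chi>1: "\<chi> (Suc 0) n = (if n mod 8 \<in> {1, 7} then 1 else if n mod 8 \<in> {3, 5} then -1 else 0)" for n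
    by (simp add: \<chi>_def)
  have \<chi>A: "\<chi> p n = real_of_int (Legendre (int n) (int p))" if "p \<in> A" for p n
    using A(2)[OF that] by (simp add: \<chi>_def)
  have trivial: "\<chi> p n = 1" if "p \<in> A" "[n = 1] (mod p)" for p n
  proof -
    have "[int n = int 1] (mod int p)" using that(2) by (simp only: cong_int_iff)
    then show ?thesis using Legendre_cong[of "int n" 1 "int p"] Legendre_one[of p] A that(1) by (simp add: \<chi>A)
  qed
  have not_dvd_1: "\<not> p dvd 1" if "p \<in> A" for p
    using A(2)[OF that] by auto
  have mod8: "n mod 8 \<in> {0, 1, 2, 3, 4, 5, 6, 7}" for n :: nat by (simp, presburger)
  have mod4: "n mod 4 \<in> {0, 1, 2, 3}" for n :: nat by (simp, presburger)
  have "\<exists>p. prime p \<and> coprime p (8 * m) \<and> (\<forall>i\<in>insert 0 (insert (Suc 0) A). \<chi> i p = (if i \<in> A then real_of_int (\<epsilon> i) else -1))"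
  proof (rule prime_with_prescribed_real_characters)
    show "finite (insert 0 (insert (Suc 0) A))" "8 * m > 0" using \<open>finite A\<close> \<open>m > 0\<close> by auto
  next
    fix i a b assume "i \<in> insert 0 (insert (Suc 0) A)"
    then consider "i = 0" | "i = Suc 0" | "i \<in> A" by auto
    then show "\<chi> i (a * b) = \<chi> i a * \<chi> i b"
    proof cases
      case 1
      have "a * b mod 4 = (a mod 4) * (b mod 4) mod 4" by (simp add: mod_mult_eq)
      then show ?thesis using mod4[of a] mod4[of b] unfolding 1 \<chi>0 by auto
    next
      case 2
      define h :: "nat \<Rightarrow> real" where "h r = (if r \<in> {1, 7} then 1 else if r \<in> {3, 5} then -1 else 0)" for r
      have H: "\<forall>x\<in>{0, 1, 2, 3, 4, 5, 6, 7}. \<forall>y\<in>{0, 1, 2, 3, 4, 5, 6, 7}. h (x * y mod 8) = h x * h y"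
        by (simp add: h_def)
      have "h ((a mod 8) * (b mod 8) mod 8) = h (a mod 8) * h (b mod 8)"
        by (rule bspec[OF bspec[OF H mod8] mod8])
      then show ?thesis unfolding 2 \<chi>1 h_def mod_mult_eq .
    next
      case 3
      then show ?thesis using A by (simp add: \<chi>A Legendre_mult)
    qed
  next
    fix i assume "i \<in> insert 0 (insert (Suc 0) A)"
    then show "\<chi> i 1 = 1" using A by (auto simp: \<chi>0 \<chi>1 \<chi>A Legendre_one)
  next
    fix i n assume "i \<in> insert 0 (insert (Suc 0) A)"
    then consider "i = 0" | "i = Suc 0" | "i \<in> A" by auto
    then show "\<chi> i (n + 8 * m) = \<chi> i n"
    proof cases
      case 1
      have "(n + 8 * m) mod 4 = n mod 4" by presburger
      then show ?thesis unfolding 1 \<chi>0 by simp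
    next
      case 2
      then show ?thesis unfolding 2 \<chi>1 by simp
    next
      case 3
      then have "[int (n + 8 * m) = int n] (mod int i)"
        using A(3)[OF 3] by (auto simp: cong_iff_dvd_diff)
      then show ?thesis using 3 by (simp add: \<chi>A Legendre_cong)
    qed
  next
    fix i n assume i: "i \<in> insert 0 (insert (Suc 0) A)" and n: "coprime n (8 * m)"
    have "odd n" using n by (auto dest: coprime_common_divisor[of _ _ 2])
    from i consider "i = 0" | "i = Suc 0" | "i \<in> A" by auto
    then show "\<chi> i n \<in> {-1, 1}"
    proof cases
      case 1
      then show ?thesis using \<open>odd n\<close> unfolding 1 \<chi>0 by simp presburger
    next
      case 2
      then show ?thesis using \<open>odd n\<close> unfolding 2 \<chi>1 by simp presburger
    next
      case 3
      then have "\<not> i dvd n" using n A[OF 3] coprime_common_divisor[of n "8 * m" i] by (auto dest: not_prime_unit)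
      then show ?thesis using 3 Legendre_values[of "int n" "int i"] Legendre_eq_0_iff[of "int n" "int i"]
        by (auto simp: \<chi>A)
    qed
  next
    fix i assume "i \<in> insert 0 (insert (Suc 0) A)"
    then consider "i = 0" | "i = Suc 0" | "i \<in> A" by auto
    \<comment> \<open>For the first two characters the classes 7, 5 and 1 modulo 8 have signs (-,+),
      (+,-) and (+,+). The third is combined with a nonresidue modulo \<open>i\<close>; all
      remaining residues are 1.\<close>
    then obtain v w where vw: "odd v" "\<And>p. p \<in> A \<Longrightarrow> \<not> p dvd w p"
      "\<And>n. [n = v] (mod 8) \<Longrightarrow> (\<forall>p\<in>A. [n = w p] (mod p)) \<Longrightarrow>
        \<chi> i n = -1 \<and> (\<forall>j\<in>insert 0 (insert (Suc 0) A) - {i}. \<chi> j n = 1)"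
    proof cases
      case 1
      have at_8: "\<chi> 0 n = -1" "\<chi> (Suc 0) n = 1" if "[n = 7] (mod 8)" for n
        using that by (auto simp: \<chi>0 \<chi>1 cong_def) presburger+
      show ?thesis
      proof (rule that[of 7 "\<lambda>_. 1"])
        fix n assume "[n = 7] (mod 8)" "\<forall>p\<in>A. [n = 1] (mod p)"
        then show "\<chi> i n = -1 \<and> (\<forall>j\<in>insert 0 (insert (Suc 0) A) - {i}. \<chi> j n = 1)"
          using at_8 trivial 1 by auto
      qed (use not_dvd_1 in auto)
    next
      case 2
      have at_8: "\<chi> 0 n = 1" "\<chi> (Suc 0) n = -1" if "[n = 5] (mod 8)" for n
        using that by (auto simp: \<chi>0 \<chi>1 cong_def) presburger+
      show ?thesis
      proof (rule that[of 5 "\<lambda>_. 1"])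
        fix n assume "[n = 5] (mod 8)" "\<forall>p\<in>A. [n = 1] (mod p)"
        then show "\<chi> i n = -1 \<and> (\<forall>j\<in>insert 0 (insert (Suc 0) A) - {i}. \<chi> j n = 1)"
          using at_8 trivial 2 by auto
      qed (use not_dvd_1 in auto)
    next
      case 3
      obtain u where u: "Legendre (int u) (int i) = -1" using exists_quadratic_nonresidue A[OF 3] by blast
      have at_8: "\<chi> 0 n = 1" "\<chi> (Suc 0) n = 1" if "[n = 1] (mod 8)" for n
        using that by (auto simp: \<chi>0 \<chi>1 cong_def) presburger+
      have at_i: "\<chi> i n = -1" if "[n = u] (mod i)" for n
        using that 3 u Legendre_cong[of "int n" "int u" "int i"] by (simp add: \<chi>A cong_int_iff)
      have "\<not> i dvd u" using u Legendre_eq_0_iff[of "int u" "int i"] by simp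
      show ?thesis
      proof (rule that[of 1 "\<lambda>p. if p = i then u else 1"])
        fix n assume n: "[n = 1] (mod 8)" "\<forall>p\<in>A. [n = (if p = i then u else 1)] (mod p)"
        have "\<chi> i n = -1" using at_i n(2) 3 by auto
        moreover have "\<chi> p n = 1" if "p \<in> A" "p \<noteq> i" for p
          using trivial[OF that(1)] n(2) that by auto
        ultimately show "\<chi> i n = -1 \<and> (\<forall>j\<in>insert 0 (insert (Suc 0) A) - {i}. \<chi> j n = 1)"
          using at_8[OF n(1)] by auto
      qed (use not_dvd_1 \<open>\<not> i dvd u\<close> in auto)
    qed
    obtain n where n: "[n = v] (mod 8)" "\<forall>p\<in>A. [n = w p] (mod p)" using crt by blast
    have "odd n" using n(1) \<open>odd v\<close> unfolding cong_def by presburger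
    moreover have "\<not> p dvd n" if "p \<in> A" for p
      using that n(2) vw(2) by (auto simp: cong_dvd_iff)
    ultimately have "coprime n (8 * m)" by (rule coprimeI)
    then show "\<exists>n. coprime n (8 * m) \<and> \<chi> i n = -1 \<and> (\<forall>j\<in>insert 0 (insert (Suc 0) A) - {i}. \<chi> j n = 1)"
      using vw(3)[OF n] by blast
  next
    fix i assume "i \<in> insert 0 (insert (Suc 0) A)"
    show "(if i \<in> A then real_of_int (\<epsilon> i) else -1) \<in> {-1, 1}"
      using \<epsilon>[of i] by (auto simp: A_def)
  qed
  then obtain q where q: "prime q" "coprime q (8 * m)"
    "\<And>i. i \<in> insert 0 (insert (Suc 0) A) \<Longrightarrow> \<chi> i q = (if i \<in> A then real_of_int (\<epsilon> i) else -1)" by blast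
  have "0 \<notin> A" "Suc 0 \<notin> A" by (auto simp: A_def)
  then have "\<chi> 0 q = -1" "\<chi> (Suc 0) q = -1" using q(3)[of 0] q(3)[of "Suc 0"] by auto
  then have "q mod 4 = 3" "q mod 8 \<in> {3, 5}" by (auto simp: \<chi>0 \<chi>1 split: if_splits)
  then have "q mod 8 = 3" by auto presburger
  moreover have "coprime q m" using q(2) by simp
  moreover have "Legendre (int q) (int p) = \<epsilon> p" if "prime p" "odd p" "p dvd m" for p
    using q(3)[of p] that \<chi>A[of p q] by (simp add: A_def)
  ultimately show ?thesis using q(1) by blast
qed

text \<open>Both symbols are completely multiplicative in the numerator. It serves to compare
  symbols modulo the auxiliary prime with symbols modulo 5.\<close>

lemma Legendre_nat_eqI:
  assumes "prime q" "2 < q" "prime r" "2 < r"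
    and "\<And>p. prime p \<Longrightarrow> p dvd m \<Longrightarrow> Legendre (int p) (int q) = Legendre (int p) (int r)"
    and "m > 0"
  shows "Legendre (int m) (int q) = Legendre (int m) (int r)"
  using assms(5,6)
proof (induction m rule: less_induct)
  case (less m)
  show ?case
  proof (cases "m = 1")
    case True
    then show ?thesis using assms by (simp add: Legendre_one)
  next
    case False
    then obtain p where p: "prime p" "p dvd m" using prime_factor_nat by blast
    then obtain n where m: "m = p * n" by blast
    then have "n > 0" "n < m" using less.prems(2) prime_gt_1_nat[OF p(1)] by auto
    have "Legendre (int n) (int q) = Legendre (int n) (int r)"
      using \<open>n < m\<close> \<open>n > 0\<close> by (rule_tac less.IH) (simp_all add: m less.prems(1))
    moreover have "Legendre (int p) (int q) = Legendre (int p) (int r)" by (rule less.prems(1)[OF p])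
    ultimately show ?thesis unfolding m of_nat_mult using assms(1-4) by (simp only: Legendre_mult)
  qed
qed

lemma Legendre_2_5: "Legendre 2 5 = -1" and Legendre_3_5: "Legendre 3 5 = -1"
proof -
  have "Legendre 2 (int 5) = -1" "Legendre 3 (int 5) = -1"
    by (rule Legendre_eqI; simp add: cong_def)+
  then show "Legendre 2 5 = -1" "Legendre 3 5 = -1" by simp_all
qed

section \<open>A ternary quadratic form\<close>

text \<open>The parameters \<open>\<alpha>\<close>, \<open>\<beta>\<close>, \<open>\<gamma>\<close> below are the coefficients of the binary form
  \<open>\<alpha> y\<^sup>2 + 2 \<beta> y z + \<gamma> z\<^sup>2\<close> that remains after completing the square in \<open>x\<close>
  in \<open>4 a\<close> times the ternary form.\<close>

lemma ternary_half_discriminant_5_unique: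
  fixes a b c d e f n :: int
  assumes "a > 0" "4 * a * c - b\<^sup>2 > 0"
    and "4 * a * c * f + b * d * e - a * e\<^sup>2 - c * d\<^sup>2 - f * b\<^sup>2 = 5"
    and "\<exists>x y z. a * x\<^sup>2 + b * x * y + c * y\<^sup>2 + d * x * z + e * y * z + f * z\<^sup>2 = n"
  shows "\<exists>x y z. x\<^sup>2 + y\<^sup>2 + 2 * z\<^sup>2 + x * y + x * z + y * z = n"
proof -
  \<comment> \<open>\<open>R\<close> keeps positivity, the half discriminant and the fact that n is
    represented. These survive the substitutions below, so no explicit equivalence is
    tracked.\<close>
  define R where "R a b c d e f \<longleftrightarrow> a > 0 \<and> 4 * a * c - b\<^sup>2 > 0 \<and>
      4 * a * c * f + b * d * e - a * e\<^sup>2 - c * d\<^sup>2 - f * b\<^sup>2 = 5 \<and>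
      (\<exists>x y z. a * x\<^sup>2 + b * x * y + c * y\<^sup>2 + d * x * z + e * y * z + f * z\<^sup>2 = n)"
    for a b c d e f :: int
  have shift_x: "R a (b + 2 * a * k) (c + b * k + a * k\<^sup>2) d (e + d * k) f" if R: "R a b c d e f" for a b c d e f k
  proof -
    obtain x y z where xyz: "a * x\<^sup>2 + b * x * y + c * y\<^sup>2 + d * x * z + e * y * z + f * z\<^sup>2 = n"
      using R unfolding R_def by blast
    have "a * (x - k * y)\<^sup>2 + (b + 2 * a * k) * (x - k * y) * y + (c + b * k + a * k\<^sup>2) * y\<^sup>2
       + d * (x - k * y) * z + (e + d * k) * y * z + f * z\<^sup>2 = n"
      unfolding xyz[symmetric] by (simp add: power2_eq_square algebra_simps)
    moreover have "4 * a * (c + b * k + a * k\<^sup>2) - (b + 2 * a * k)\<^sup>2 = 4 * a * c - b\<^sup>2" by (simp add: power2_eq_square algebra_simps)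
    moreover have "4 * a * (c + b * k + a * k\<^sup>2) * f + (b + 2 * a * k) * d * (e + d * k) - a * (e + d * k)\<^sup>2
      - (c + b * k + a * k\<^sup>2) * d\<^sup>2 - f * (b + 2 * a * k)\<^sup>2
      = 4 * a * c * f + b * d * e - a * e\<^sup>2 - c * d\<^sup>2 - f * b\<^sup>2" by (simp add: power2_eq_square algebra_simps)
    ultimately show ?thesis using R unfolding R_def by metis
  qed
  have shift_y: "R a b c (d + b * k) (e + 2 * c * k) (f + e * k + c * k\<^sup>2)" if R: "R a b c d e f" for a b c d e f k
  proof -
    obtain x y z where xyz: "a * x\<^sup>2 + b * x * y + c * y\<^sup>2 + d * x * z + e * y * z + f * z\<^sup>2 = n"
      using R unfolding R_def by blast
    have "a * x\<^sup>2 + b * x * (y - k * z) + c * (y - k * z)\<^sup>2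
       + (d + b * k) * x * z + (e + 2 * c * k) * (y - k * z) * z + (f + e * k + c * k\<^sup>2) * z\<^sup>2 = n"
      unfolding xyz[symmetric] by (simp add: power2_eq_square algebra_simps)
    moreover have "4 * a * c * (f + e * k + c * k\<^sup>2) + b * (d + b * k) * (e + 2 * c * k) - a * (e + 2 * c * k)\<^sup>2
      - c * (d + b * k)\<^sup>2 - (f + e * k + c * k\<^sup>2) * b\<^sup>2
      = 4 * a * c * f + b * d * e - a * e\<^sup>2 - c * d\<^sup>2 - f * b\<^sup>2" by (simp add: power2_eq_square algebra_simps)
    ultimately show ?thesis using R unfolding R_def by metis
  qed
  have swap_xy: "R c b a e d f" if R: "R a b c d e f" for a b c d e f
  proof -
    obtain x y z where xyz: "a * x\<^sup>2 + b * x * y + c * y\<^sup>2 + d * x * z + e * y * z + f * z\<^sup>2 = n"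
      using R unfolding R_def by blast
    then have "c * y\<^sup>2 + b * y * x + a * x\<^sup>2 + e * y * z + d * x * z + f * z\<^sup>2 = n" by (simp add: power2_eq_square algebra_simps)
    moreover have "0 < a * c"
      using R zero_le_power2[of b] unfolding R_def by linarith
    then have "c > 0" using R unfolding R_def by (simp add: zero_less_mult_iff)
    moreover have "4 * c * a - b\<^sup>2 > 0" "4 * c * a * f + b * e * d - c * d\<^sup>2 - a * e\<^sup>2 - f * b\<^sup>2 = 5"
      using R unfolding R_def by (simp_all add: algebra_simps)
    ultimately show ?thesis unfolding R_def by blast
  qed
  have swap_yz: "R a d f b e c" if R: "R a b c d e f" "4 * a * f - d\<^sup>2 > 0" for a b c d e f
  proof -
    obtain x y z where xyz: "a * x\<^sup>2 + b * x * y + c * y\<^sup>2 + d * x * z + e * y * z + f * z\<^sup>2 = n"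
      using R unfolding R_def by blast
    then have "a * x\<^sup>2 + d * x * z + f * z\<^sup>2 + b * x * y + e * z * y + c * y\<^sup>2 = n" by (simp add: power2_eq_square algebra_simps)
    moreover have "4 * a * f * c + d * b * e - a * e\<^sup>2 - f * b\<^sup>2 - c * d\<^sup>2 = 5" "a > 0"
      using R unfolding R_def by (simp_all add: algebra_simps)
    ultimately show ?thesis using R(2) unfolding R_def by blast
  qed
  have "R a b c d e f" using assms unfolding R_def by blast
  \<comment> \<open>The leading coefficient is minimized first, then \<alpha> = 4 a c - b^2 among
    the forms with that leading coefficient.\<close>
  then obtain a where a: "\<exists>b c d e f. R a b c d e f"
    and a_min: "\<And>a' b c d e f. R a' b c d e f \<Longrightarrow> nat a \<le> nat a'"
    using ex_has_least_nat[of "\<lambda>a. \<exists>b c d e f. R a b c d e f" a nat] by metis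
  then obtain b c d e f where "R a b c d e f" by blast
  then obtain \<alpha> where "\<exists>b c d e f. R a b c d e f \<and> 4 * a * c - b\<^sup>2 = \<alpha>"
    and \<alpha>_min: "\<And>b c d e f. R a b c d e f \<Longrightarrow> nat \<alpha> \<le> nat (4 * a * c - b\<^sup>2)"
    using ex_has_least_nat[of "\<lambda>\<alpha>. \<exists>b c d e f. R a b c d e f \<and> 4 * a * c - b\<^sup>2 = \<alpha>" "4 * a * c - b\<^sup>2" nat]
    by metis
  then obtain b1 c1 d e f where R1: "R a b1 c1 d e f" "4 * a * c1 - b1\<^sup>2 = \<alpha>" by blast
  have "a > 0" "\<alpha> > 0" using R1 by (auto simp: R_def)
  \<comment> \<open>The shift in x reduces b to the smallest absolute residue modulo 2 a and leaves
    \<alpha> unchanged.\<close>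
  define b where "b = b1 + 2 * a * (- ((b1 + a) div (2 * a)))"
  have "b = (b1 + a) mod (2 * a) - a"
    unfolding b_def by (simp add: minus_div_mult_eq_mod[symmetric] algebra_simps)
  then have b_le: "\<bar>b\<bar> \<le> a"
    using pos_mod_bound[of "2 * a" "b1 + a"] pos_mod_sign[of "2 * a" "b1 + a"] \<open>a > 0\<close> by linarith
  obtain c e1 where R2: "R a b c d e1 f" "4 * a * c - b\<^sup>2 = \<alpha>"
  proof -
    define k where "k = - ((b1 + a) div (2 * a))"
    have "R a b (c1 + b1 * k + a * k\<^sup>2) d (e + d * k) f"
      unfolding b_def using shift_x[OF R1(1), of k] by (simp add: k_def)
    moreover have "4 * a * (c1 + b1 * k + a * k\<^sup>2) - b\<^sup>2 = \<alpha>"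
      unfolding R1(2)[symmetric] b_def k_def[symmetric] by (simp add: power2_eq_square algebra_simps)
    ultimately show ?thesis using that by blast
  qed
  have "c > 0" using swap_xy[OF R2(1)] by (simp add: R_def)
  then have "a \<le> c" using a_min[OF swap_xy[OF R2(1)]] \<open>a > 0\<close> by simp
  define \<beta>1 where "\<beta>1 = 2 * a * e1 - b * d"
  \<comment> \<open>The shift of y by multiples of z moves \<beta> by multiples of \<alpha>, so this
    k makes 2 \<beta> at most \<alpha> in absolute value.\<close>
  define k where "k = - ((2 * \<beta>1 + \<alpha>) div (2 * \<alpha>))"
  define d' e' f' \<beta> where "d' = d + b * k" and "e' = e1 + 2 * c * k" and "f' = f + e1 * k + c * k\<^sup>2"
    and "\<beta> = 2 * a * e' - b * d'"
  have R3: "R a b c d' e' f'" unfolding d'_def e'_def f'_def by (rule shift_y[OF R2(1)])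
  have "\<beta> = \<beta>1 + k * \<alpha>"
    unfolding \<beta>_def \<beta>1_def d'_def e'_def R2(2)[symmetric] by (simp add: power2_eq_square algebra_simps)
  then have "2 * \<beta> = (2 * \<beta>1 + \<alpha>) mod (2 * \<alpha>) - \<alpha>"
    unfolding k_def by (simp add: minus_div_mult_eq_mod[symmetric] algebra_simps)
  then have \<beta>_le: "\<bar>2 * \<beta>\<bar> \<le> \<alpha>"
    using pos_mod_bound[of "2 * \<alpha>" "2 * \<beta>1 + \<alpha>"] pos_mod_sign[of "2 * \<alpha>" "2 * \<beta>1 + \<alpha>"] \<open>\<alpha> > 0\<close> by linarith
  define \<gamma> where "\<gamma> = 4 * a * f' - d'\<^sup>2"
  have "\<alpha> * \<gamma> - \<beta>\<^sup>2 = 4 * a * (4 * a * c * f' + b * d' * e' - a * e'\<^sup>2 - c * d'\<^sup>2 - f' * b\<^sup>2)"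
    unfolding R2(2)[symmetric] \<gamma>_def \<beta>_def by (simp add: power2_eq_square algebra_simps)
  then have det: "\<alpha> * \<gamma> = \<beta>\<^sup>2 + 20 * a" using R3 by (simp add: R_def)
  then have "\<alpha> * \<gamma> > 0" using \<open>a > 0\<close> by (simp add: add_nonneg_pos)
  then have "\<gamma> > 0" using \<open>\<alpha> > 0\<close> by (simp add: zero_less_mult_iff)
  \<comment> \<open>Exchanging y and z keeps a and replaces \<alpha> by \<gamma>, so minimality of
    \<alpha> gives \<alpha> \<le> \<gamma>.\<close>
  then have "R a d' f' b e' c" using swap_yz[OF R3] by (simp add: \<gamma>_def)
  then have "\<alpha> \<le> \<gamma>" using \<alpha>_min \<open>\<gamma> > 0\<close> \<open>\<alpha> > 0\<close> by (fastforce simp: \<gamma>_def)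
  then have "\<alpha> * \<alpha> \<le> \<alpha> * \<gamma>" using \<open>\<alpha> > 0\<close> by simp
  moreover have "(2 * \<beta>)\<^sup>2 \<le> \<alpha>\<^sup>2" using \<beta>_le \<open>\<alpha> > 0\<close> abs_le_square_iff by fastforce
  ultimately have \<alpha>_le: "3 * \<alpha>\<^sup>2 \<le> 80 * a" using det by (simp add: power2_eq_square)
  have "b\<^sup>2 \<le> a\<^sup>2" using b_le \<open>a > 0\<close> abs_le_square_iff by fastforce
  moreover have "a * a \<le> a * c" using \<open>a \<le> c\<close> \<open>a > 0\<close> by simp
  ultimately have \<alpha>_ge: "3 * a\<^sup>2 \<le> \<alpha>" using R2(2) by (simp add: power2_eq_square)
  \<comment> \<open>The two bounds 3 a^2 \<le> \<alpha> and 3 \<alpha>^2 \<le> 80 a combine to 27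
    a^3 \<le> 80.\<close>
  have "a = 1"
  proof (rule ccontr)
    assume "a \<noteq> 1"
    then have "a \<ge> 2" using \<open>a > 0\<close> by simp
    have "(3 * a\<^sup>2)\<^sup>2 \<le> \<alpha>\<^sup>2" using \<alpha>_ge by (intro power_mono) auto
    then have "27 * (a ^ 3 * a) \<le> 80 * a" using \<alpha>_le by (simp add: power2_eq_square power3_eq_cube)
    moreover have "2 ^ 3 \<le> a ^ 3" using \<open>a \<ge> 2\<close> by (intro power_mono) auto
    then have "8 * a \<le> a ^ 3 * a" using \<open>a > 0\<close> by (intro mult_right_mono) auto
    ultimately show False using \<open>a > 0\<close> by linarith
  qed
  have "\<alpha> \<le> 5"
  proof (rule ccontr)
    assume "\<not> \<alpha> \<le> 5"
    then have "6\<^sup>2 \<le> \<alpha>\<^sup>2" by (intro power_mono) auto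
    then show False using \<alpha>_le \<open>a = 1\<close> by simp
  qed
  have "b \<in> {-1, 0, 1}" using b_le \<open>a = 1\<close> by auto
  then have b_sq: "b\<^sup>2 = (if b = 0 then 0 else 1)" by auto
  have "c = 1" using \<open>\<alpha> \<le> 5\<close> R2(2) \<open>a = 1\<close> b_sq \<open>a \<le> c\<close> by (auto split: if_splits)
  have mod4: "\<gamma> mod 4 = 0 \<or> \<gamma> mod 4 = 3"
  proof -
    have "d' mod 4 \<in> {0, 1, 2, 3}" by auto
    then have "d'\<^sup>2 mod 4 = 0 \<or> d'\<^sup>2 mod 4 = 1"
      by (subst (1 2) power_mod[symmetric]) auto
    then show ?thesis unfolding \<gamma>_def \<open>a = 1\<close> by presburger
  qed
  \<comment> \<open>With b = 0 the determinant relation leaves \<gamma> = 5 or 6, excluded modulo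
    4.\<close>
  have "b \<noteq> 0"
  proof
    assume "b = 0"
    then have "\<alpha> = 4" "\<beta> = 2 * e'" using R2(2) \<open>a = 1\<close> \<open>c = 1\<close> by (auto simp: \<beta>_def)
    then have "e' \<in> {-1, 0, 1}" "\<gamma> = e'\<^sup>2 + 5" using \<beta>_le det \<open>a = 1\<close> by auto
    then show False using mod4 by auto
  qed
  then have "\<alpha> = 3" using R2(2) b_sq \<open>a = 1\<close> \<open>c = 1\<close> by simp
  \<comment> \<open>Divisibility of \<beta>^2 + 20 by 3 excludes \<beta> = 0.\<close>
  then have "\<beta> \<in> {-1, 0, 1}" "3 * \<gamma> = \<beta>\<^sup>2 + 20" using \<beta>_le det \<open>a = 1\<close> by auto
  then have \<beta>: "\<beta> * \<beta> = 1" and \<gamma>: "\<gamma> = 7" by (auto, presburger+)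
  have "odd b" using \<open>b \<in> {-1, 0, 1}\<close> \<open>b \<noteq> 0\<close> by auto
  have "odd d'" using \<gamma> unfolding \<gamma>_def \<open>a = 1\<close> by (auto elim!: evenE simp: power2_eq_square) presburger
  moreover have "odd \<beta>" using \<beta> by (metis even_mult_iff odd_one)
  ultimately have "odd (d' * \<beta>)" by simp
  obtain b' where b': "b = 2 * b' + 1" using \<open>odd b\<close> by (elim oddE)
  obtain d'' where d'': "d' * \<beta> = 2 * d'' + 1" using \<open>odd (d' * \<beta>)\<close> by (elim oddE)
  obtain x y z where xyz: "a * x\<^sup>2 + b * x * y + c * y\<^sup>2 + d' * x * z + e' * y * z + f' * z\<^sup>2 = n"
    using R3 R_def by blast
  \<comment> \<open>Four times the target form is (2 x + y + z)^2 + 3 y^2 + 2 y z + 7 z^2, so its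
    binary part has \<beta> = 1. The sign in z' normalizes \<beta>, and since \<open>b\<close> and
    \<open>d' * \<beta>\<close> are odd, x' can absorb the difference of the linear terms.\<close>
  define z' where "z' = \<beta> * z"
  define x' where "x' = x + b' * y + d'' * z'"
  have "2 * x' + y + z' = 2 * x + b * y + d' * \<beta> * z'"
    unfolding x'_def b' d'' by (simp add: power2_eq_square algebra_simps)
  also have "\<dots> = 2 * x + b * y + d' * z"
    using \<beta> unfolding z'_def by (simp add: mult.assoc)
  finally have lin: "2 * x' + y + z' = 2 * x + b * y + d' * z" .
  have z_sq: "z'\<^sup>2 = z\<^sup>2" using \<beta> by (simp add: z'_def power_mult_distrib power2_eq_square)
  have "4 * (x'\<^sup>2 + y\<^sup>2 + 2 * z'\<^sup>2 + x' * y + x' * z' + y * z')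
      = (2 * x' + y + z')\<^sup>2 + 3 * y\<^sup>2 + 2 * y * z' + 7 * z'\<^sup>2" by (simp add: power2_eq_square algebra_simps)
  also have "\<dots> = (2 * x + b * y + d' * z)\<^sup>2 + \<alpha> * y\<^sup>2 + 2 * \<beta> * y * z + \<gamma> * z\<^sup>2"
    unfolding lin \<open>\<alpha> = 3\<close> \<gamma> by (simp add: z_sq, simp add: z'_def)
  also have "\<dots> = 4 * (a * x\<^sup>2 + b * x * y + c * y\<^sup>2 + d' * x * z + e' * y * z + f' * z\<^sup>2)"
    unfolding R2(2)[symmetric] \<beta>_def \<gamma>_def \<open>a = 1\<close> by (simp add: power2_eq_square algebra_simps)
  finally have "x'\<^sup>2 + y\<^sup>2 + 2 * z'\<^sup>2 + x' * y + x' * z' + y * z' = n"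
    unfolding xyz by (metis mult_cancel_left zero_neq_numeral)
  then show ?thesis by blast
qed

text \<open>The substitution \<open>X = x + 2 z\<close>, \<open>Y = z - x - y\<close>, \<open>Z = y + 2 z\<close> identifies the form of half
  discriminant 5 with \<open>(X\<^sup>2 + Y\<^sup>2 + Z\<^sup>2 - 5 z\<^sup>2) / 2\<close> on the lattice \<open>X + Y + Z = 5 z\<close>; the latter
  is anisotropic modulo 5, so a value divisible by 5 forces \<open>X\<close>, \<open>Y\<close>, \<open>Z\<close> to be divisible by 5.\<close>

lemma scaled_value_of_ternary_form:
  fixes x y z m :: int
  assumes "x\<^sup>2 + y\<^sup>2 + 2 * z\<^sup>2 + x * y + x * z + y * z = 5 * m"
  shows "\<exists>X Y Z. 5 * (X\<^sup>2 + Y\<^sup>2 + Z\<^sup>2) - (X + Y + Z)\<^sup>2 = 2 * m"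
proof -
  define X Y Z where "X = x + 2 * z" and "Y = z - x - y" and "Z = y + 2 * z"
  have eq: "X\<^sup>2 + Y\<^sup>2 + Z\<^sup>2 - 5 * z\<^sup>2 = 10 * m"
    unfolding X_def Y_def Z_def using assms by (simp add: power2_eq_square algebra_simps)
  have sum: "X + Y + Z = 5 * z" by (simp add: X_def Y_def Z_def)
  \<comment> \<open>Eliminating Z leaves X^2 + X Y + Y^2 divisible by 5; its discriminant -3 is a
    nonresidue modulo 5.\<close>
  have "5 dvd X \<and> 5 dvd Y"
  proof -
    have Z: "Z = 5 * z - X - Y" using sum by simp
    have "2 * (X\<^sup>2 + Y\<^sup>2 + X * Y) = 5 * (2 * m - 4 * z\<^sup>2 + 2 * z * X + 2 * z * Y)"
      using eq unfolding Z by (simp add: power2_eq_square algebra_simps)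
    then have "(X * X + Y * Y + X * Y) mod 5 = 0" unfolding power2_eq_square by presburger
    moreover have "(X * X + Y * Y + X * Y) mod 5
        = ((X mod 5) * (X mod 5) + (Y mod 5) * (Y mod 5) + (X mod 5) * (Y mod 5)) mod 5"
      unfolding cong_def[symmetric] by (intro cong_add cong_mult) (simp_all add: cong_def)
    ultimately have "((X mod 5) * (X mod 5) + (Y mod 5) * (Y mod 5) + (X mod 5) * (Y mod 5)) mod 5 = 0" by simp
    moreover have "X mod 5 \<in> {0, 1, 2, 3, 4}" "Y mod 5 \<in> {0, 1, 2, 3, 4}" by (simp, presburger)+
    ultimately have "X mod 5 = 0 \<and> Y mod 5 = 0" by (elim insertE emptyE) simp_all
    then show ?thesis by auto
  qed
  moreover from this have "5 dvd Z" using sum by presburger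
  ultimately obtain X' Y' Z' where XYZ: "X = 5 * X'" "Y = 5 * Y'" "Z = 5 * Z'" by (elim conjE dvdE)
  then have "z = X' + Y' + Z'" using sum by simp
  moreover have "5 * (X'\<^sup>2 + Y'\<^sup>2 + Z'\<^sup>2) - z\<^sup>2 = 2 * m"
    using eq unfolding XYZ by (simp add: power_mult_distrib)
  ultimately show ?thesis by metis
qed

section \<open>A form of half discriminant 5 with value 5 m\<close>

text \<open>Completing the square in the form with leading coefficient 5 m, xy-coefficient 5 r and
  xz-coefficient 10 s leaves 5 (q y^2 + 4 t y z + 4 u z^2). Its determinant is fixed by
  \<open>eq\<close>, and the divisibilities say that the other three coefficients A, B, C are
  integers.\<close>

lemma value_from_residues:
  fixes q r s t u m :: int
  assumes pos: "q > 0" "m > 0"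
    and dvd: "4 * m dvd q + 5 * r\<^sup>2" "m dvd t + 5 * r * s" "m dvd u + 5 * s\<^sup>2"
    and eq: "q * u = t\<^sup>2 + m"
  shows "\<exists>X Y Z. 5 * (X\<^sup>2 + Y\<^sup>2 + Z\<^sup>2) - (X + Y + Z)\<^sup>2 = 2 * m"
proof -
  obtain A B C where A: "q + 5 * r\<^sup>2 = 4 * m * A" and B: "t + 5 * r * s = m * B" and C: "u + 5 * s\<^sup>2 = m * C"
    using dvd by (elim dvdE)
  have "\<exists>x y z. x\<^sup>2 + y\<^sup>2 + 2 * z\<^sup>2 + x * y + x * z + y * z = 5 * m"
  proof (rule ternary_half_discriminant_5_unique)
    show "5 * m > 0" using pos by simp
    have "4 * (5 * m) * A - (5 * r)\<^sup>2 = 5 * q"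
      using A by (simp add: power2_eq_square algebra_simps)
    then show "4 * (5 * m) * A - (5 * r)\<^sup>2 > 0" using pos by simp
    have "4 * m * (4 * (5 * m) * A * C + 5 * r * (10 * s) * B - 5 * m * B\<^sup>2 - A * (10 * s)\<^sup>2 - C * (5 * r)\<^sup>2)
      = 20 * ((4 * m * A - 5 * r\<^sup>2) * (m * C - 5 * s\<^sup>2) - (m * B - 5 * r * s)\<^sup>2)"
      by (simp add: power2_eq_square algebra_simps)
    also have "\<dots> = 20 * (q * u - t\<^sup>2)"
      unfolding A[symmetric] B[symmetric] C[symmetric] by simp
    also have "\<dots> = 4 * m * 5" using eq by simp
    finally show "4 * (5 * m) * A * C + 5 * r * (10 * s) * B - 5 * m * B\<^sup>2 - A * (10 * s)\<^sup>2 - C * (5 * r)\<^sup>2 = 5"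
      using pos by simp
    show "\<exists>x y z. 5 * m * x\<^sup>2 + 5 * r * x * y + A * y\<^sup>2 + 10 * s * x * z + B * y * z + C * z\<^sup>2 = 5 * m"
      by (rule exI[of _ 1], rule exI[of _ 0], rule exI[of _ 0]) simp
  qed
  then show ?thesis using scaled_value_of_ternary_form by blast
qed

text \<open>The conditions on q supply a root r of q + 5 r^2 modulo 4 m and a root t of t^2 + m
  modulo q; then 5 r s = -t is solved modulo m. Squarefreeness makes roots modulo the single primes
  suffice for r.\<close>

lemma squarefree_value_mod_5:
  fixes m :: nat
  assumes "squarefree m" "m mod 5 \<in> {2, 3}"
  shows "\<exists>X Y Z :: int. 5 * (X\<^sup>2 + Y\<^sup>2 + Z\<^sup>2) - (X + Y + Z)\<^sup>2 = 2 * int m"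
proof -
  have "m > 0" using assms(1) by (auto intro: Nat.gr0I)
  have not5: "p \<noteq> 5" if "p dvd m" for p using that assms(2) by auto
  have odd_gt: "p > 2" if "prime p" "odd p" for p :: nat
    using that prime_ge_2_nat[of p] by (auto intro: le_neq_implies_less)
  have sym: "Legendre (-5) (int p) \<in> {-1, 1}" if "prime p" "odd p" "p dvd m" for p
  proof -
    have "\<not> p dvd 5" using that not5[of p] primes_dvd_imp_eq[of p 5] by auto
    then have "\<not> int p dvd -5" by (metis dvd_minus_iff int_dvd_int_iff of_nat_numeral)
    then show ?thesis using Legendre_values[of "-5" "int p"] Legendre_eq_0_iff[of "-5" "int p"] by auto
  qed
  obtain q where q: "prime q" "q mod 8 = 3" "coprime q m"
    and q_sym: "\<And>p. prime p \<Longrightarrow> odd p \<Longrightarrow> p dvd m \<Longrightarrow> Legendre (int q) (int p) = Legendre (-5) (int p)"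
    using prime_with_prescribed_Legendre_symbols[OF \<open>m > 0\<close>, of "\<lambda>p. Legendre (-5) (int p)"] sym by blast
  have "q > 2" using q(2) by (rule_tac ccontr) simp
  \<comment> \<open>Reciprocity turns (q/p) = (-5/p) into (p/q) = (p/5) for odd p, and both sides
    are -1 for p = 2. Hence (m/q) = (m/5) = -1, and (-1/q) = -1 makes -m a residue.\<close>
  obtain t where t: "[t\<^sup>2 = - int m] (mod int q)"
  proof -
    have "Legendre (int p) (int q) = Legendre (int p) (int 5)" if p: "prime p" "p dvd m" for p
    proof (cases "odd p")
      case True
      then have "p > 2" using odd_gt p by blast
      have "p \<noteq> q"
        using p q coprime_common_divisor[of q m p] by (auto dest: not_prime_unit)
      have "odd ((q - 1) div 2)" using q(2) by presburger
      then have "Legendre (int p) (int q) * Legendre (int q) (int p) = Legendre (-1) (int p)"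
        using Quadratic_Reciprocity[of p q] p q \<open>p > 2\<close> \<open>q > 2\<close> \<open>p \<noteq> q\<close>
        by (simp add: Legendre_minus_one power_mult minus_one_power_iff)
      then have "Legendre (int p) (int q) * (Legendre (-1) (int p) * Legendre 5 (int p)) = Legendre (-1) (int p)"
        using q_sym[OF p(1) True p(2)] Legendre_mult[OF p(1) \<open>p > 2\<close>, of "-1" 5] by simp
      moreover have "Legendre (-1) (int p) \<noteq> 0"
        using Legendre_minus_one[OF p(1) \<open>p > 2\<close>] by simp
      ultimately have "Legendre (int p) (int q) * Legendre 5 (int p) = 1" by (simp add: mult.left_commute)
      moreover have "Legendre (int p) (int 5) * Legendre (int 5) (int p) = 1"
        using Quadratic_Reciprocity[of p 5] p \<open>p > 2\<close> not5[of p] by simp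
      moreover have "Legendre 5 (int p) \<noteq> 0" using calculation by auto
      ultimately show ?thesis by (metis mult_right_cancel of_nat_numeral)
    next
      case False
      then have "p = 2" using p(1) primes_dvd_imp_eq[of 2 p] by auto
      then show ?thesis using Legendre_two_mod_8_eq_3[OF q(1,2)] Legendre_2_5 by simp
    qed
    then have "Legendre (int m) (int q) = Legendre (int m) (int 5)"
      using q(1) \<open>q > 2\<close> \<open>m > 0\<close> by (rule_tac Legendre_nat_eqI) simp_all
    also have "\<dots> = -1"
    proof -
      have "[int m = int (m mod 5)] (mod 5)" by (simp add: cong_def zmod_int)
      then have "Legendre (int m) 5 = Legendre (int (m mod 5)) 5" by (rule Legendre_cong)
      then show ?thesis using assms(2) Legendre_2_5 Legendre_3_5 by auto
    qed
    finally have "Legendre (int m) (int q) = -1" .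
    moreover have "odd ((q - 1) div 2)" using q(2) by presburger
    then have "Legendre (-1) (int q) = -1"
      using Legendre_minus_one[OF q(1) \<open>q > 2\<close>] by (simp add: minus_one_power_iff)
    ultimately have "Legendre (- int m) (int q) = 1"
      using Legendre_mult[OF q(1) \<open>q > 2\<close>, of "-1" "int m"] by simp
    then show ?thesis using that Legendre_eq_1_imp_QuadRes by blast
  qed
  then obtain u where u: "int q * u = t\<^sup>2 + int m" by (metis cong_iff_dvd_diff diff_minus_eq_add dvdE)
  define A where "A = {p. prime p \<and> odd p \<and> p dvd m}"
  have "finite A" unfolding A_def using \<open>m > 0\<close> by (intro finite_subset[OF _ finite_divisors_nat[of m]]) auto
  have cop: "coprime i j" if "i \<in> insert 8 A" "j \<in> insert 8 A" "i \<noteq> j" for i j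
  proof -
    have "coprime 8 p" if "p \<in> A" for p
      using that coprime_power_left_iff[of 2 3 p] by (simp add: A_def)
    then show ?thesis using that primes_coprime[of i j] by (auto simp: coprime_commute A_def)
  qed
  have local_root: "\<exists>r::nat. p dvd q + 5 * r\<^sup>2" if "p \<in> insert 8 A" for p
  proof (cases "p = 8")
    case True
    \<comment> \<open>The modulus is 8 rather than 4 because m may be even, and then 4 m has 2-part
      8.\<close>
    have "8 dvd q + 5" using q(2) by presburger
    then show ?thesis using True by (intro exI[of _ 1]) simp
  next
    case False
    then have p: "prime p" "odd p" "p dvd m" using that by (auto simp: A_def)
    then have "p > 2" using odd_gt by blast
    have "Legendre (int q * -5) (int p) = 1"
      using Legendre_mult[OF p(1) \<open>p > 2\<close>, of "int q" "-5"] q_sym[OF p] sym[OF p] by auto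
    then obtain y where y: "[y\<^sup>2 = int q * -5] (mod int p)" using Legendre_eq_1_imp_QuadRes by blast
    have "coprime 5 p" using p not5[of p] by (intro primes_coprime) auto
    then have "coprime (int 5) (int p)" by (simp only: coprime_int_iff)
    then have "coprime 5 (int p)" by simp
    then obtain i where i: "[5 * i = 1] (mod int p)" using cong_solve_coprime_int by blast
    \<comment> \<open>With y^2 = -5 q, the quotient r = y / 5 satisfies 5 r^2 = -q modulo p;
      \<open>i\<close> is the inverse of 5.\<close>
    define r where "r = nat (y * i mod int p)"
    have r: "[int r = y * i] (mod int p)" using \<open>p > 2\<close> by (simp add: r_def)
    have "[int q + 5 * (int r)\<^sup>2 = int q + 5 * (y * i)\<^sup>2] (mod int p)"
      using r by (intro cong_add cong_mult cong_pow) auto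
    also have "int q + 5 * (y * i)\<^sup>2 = int q + 5 * i\<^sup>2 * y\<^sup>2" by (simp add: power_mult_distrib)
    also have "[\<dots> = int q + 5 * i\<^sup>2 * (int q * -5)] (mod int p)"
      using y by (intro cong_add cong_mult) auto
    also have "int q + 5 * i\<^sup>2 * (int q * -5) = int q - int q * (5 * i)\<^sup>2" by (simp add: power_mult_distrib)
    also have "[\<dots> = int q - int q * 1\<^sup>2] (mod int p)"
      using i by (intro cong_diff cong_mult cong_pow) auto
    finally have "int p dvd int (q + 5 * r\<^sup>2)" by (simp add: cong_0_iff)
    then show ?thesis by (auto simp only: of_nat_dvd_iff)
  qed
  obtain r :: nat where r: "\<And>p. p \<in> insert 8 A \<Longrightarrow> p dvd q + 5 * r\<^sup>2"
  proof -
    obtain f :: "nat \<Rightarrow> nat" where f: "\<And>p. p \<in> insert 8 A \<Longrightarrow> p dvd q + 5 * (f p)\<^sup>2"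
      using local_root by metis
    obtain r where r: "\<forall>p\<in>insert 8 A. [r = f p] (mod p)"
      using chinese_remainder_nat[of "insert 8 A" "\<lambda>p. p" f] \<open>finite A\<close> cop by blast
    have "p dvd q + 5 * r\<^sup>2" if "p \<in> insert 8 A" for p
    proof -
      have "[q + 5 * r\<^sup>2 = q + 5 * (f p)\<^sup>2] (mod p)"
        using r that by (intro cong_add cong_mult cong_pow) auto
      then show ?thesis using f[OF that] cong_dvd_iff by blast
    qed
    then show ?thesis using that by blast
  qed
  have "q + 5 * r\<^sup>2 > 0" using \<open>q > 2\<close> by simp
  have r_dvd: "4 * m dvd q + 5 * r\<^sup>2"
  proof (rule multiplicity_le_imp_dvd)
    fix p :: nat assume p: "prime p"
    have sqf: "multiplicity p m \<le> 1"
      using assms(1) p \<open>m > 0\<close> by (subst (asm) squarefree_factorial_semiring'') auto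
    show "multiplicity p (4 * m) \<le> multiplicity p (q + 5 * r\<^sup>2)"
    proof (cases "p = 2")
      case True
      have "multiplicity (2::nat) (2 ^ 2) = 2" by (rule multiplicity_same_power) auto
      then have "multiplicity 2 (4 * m) = 2 + multiplicity 2 m"
        using \<open>m > 0\<close> by (subst prime_elem_multiplicity_mult_distrib) auto
      then have "multiplicity p (4 * m) \<le> 3" using sqf True by simp
      also have "3 \<le> multiplicity p (q + 5 * r\<^sup>2)"
        using r[of 8] \<open>q + 5 * r\<^sup>2 > 0\<close> True by (intro multiplicity_geI) auto
      finally show ?thesis .
    next
      case False
      then have "\<not> p dvd 4" using p prime_dvd_power[of p 2 2] primes_dvd_imp_eq[of p 2] by auto
      then have eq: "multiplicity p (4 * m) = multiplicity p m"
        using p \<open>m > 0\<close> by (simp add: prime_elem_multiplicity_mult_distrib not_dvd_imp_multiplicity_0)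
      show ?thesis
      proof (cases "p dvd m")
        case True
        then have "p \<in> A" using p False primes_dvd_imp_eq[of 2 p] by (auto simp: A_def)
        then have "1 \<le> multiplicity p (q + 5 * r\<^sup>2)"
          using r[of p] p \<open>q + 5 * r\<^sup>2 > 0\<close> by (intro multiplicity_geI) (auto simp: not_prime_unit)
        then show ?thesis using eq sqf by simp
      qed (simp add: eq not_dvd_imp_multiplicity_0)
    qed
  qed (use \<open>m > 0\<close> in simp)
  \<comment> \<open>This makes the congruence for s solvable: a common prime of r and m would also
    divide q.\<close>
  have "coprime (5 * r) m"
  proof (rule coprime_nat_primeI)
    fix p assume p: "prime p" "p dvd 5 * r" "p dvd m"
    then have "p dvd r" using not5[of p] primes_dvd_imp_eq[of p 5] by (auto simp: prime_dvd_mult_iff)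
    moreover have "p dvd q + 5 * r\<^sup>2" using p(3) r_dvd by (meson dvd_mult dvd_trans)
    ultimately have "p dvd q" by (metis dvd_add_left_iff dvd_mult dvd_mult2 power2_eq_square)
    then show False using p q(3) coprime_common_divisor[of q m p] by (auto dest: not_prime_unit)
  qed
  then have "coprime (5 * int r) (int m)" by (simp flip: coprime_int_iff)
  then obtain x where x: "[5 * int r * x = 1] (mod int m)" using cong_solve_coprime_int by blast
  define s where "s = - t * x"
  have "[- t * (5 * int r * x) = - t * 1] (mod int m)" using x by (intro cong_mult) auto
  then have s: "[5 * int r * s = - t] (mod int m)" by (simp add: s_def algebra_simps)
  show ?thesis
  proof (rule value_from_residues)
    show "int q > 0" "int m > 0" using \<open>q > 2\<close> \<open>m > 0\<close> by auto
    show q_dvd: "4 * int m dvd int q + 5 * (int r)\<^sup>2" 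
    proof -
      have "int (4 * m) dvd int (q + 5 * r\<^sup>2)" using r_dvd by (simp only: of_nat_dvd_iff)
      then show ?thesis by simp
    qed
    show d: "int m dvd t + 5 * int r * s" using s by (simp add: cong_iff_dvd_diff add.commute)
    show "int q * u = t\<^sup>2 + int m" by (rule u)
    \<comment> \<open>The third divisibility follows from the first two after multiplication by q,
      which is coprime to m.\<close>
    have "int q * (u + 5 * s\<^sup>2) = t\<^sup>2 + int m + 5 * int q * s\<^sup>2"
      using u by (simp add: algebra_simps)
    also have "\<dots> = (t - 5 * int r * s) * (t + 5 * int r * s) + int m + 5 * s\<^sup>2 * (int q + 5 * (int r)\<^sup>2)"
      by (simp add: power2_eq_square algebra_simps)
    also have "int m dvd \<dots>"
      by (rule dvd_add[OF dvd_add[OF dvd_mult[OF d] dvd_refl] dvd_mult[OF dvd_mult_right[OF q_dvd]]])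
    finally have "int m dvd int q * (u + 5 * s\<^sup>2)" .
    then show "int m dvd u + 5 * s\<^sup>2" using q(3) by (simp add: coprime_dvd_mult_right_iff coprime_commute)
  qed
qed

section \<open>Sums of pentagonal numbers\<close>

text \<open>Squares of units are 1 or 4 modulo 5, so the squarefree part stays in the classes 2, 3;
  its representation is scaled by \<open>k\<close>.\<close>

lemma value_mod_5:
  fixes m :: nat
  assumes "m mod 5 \<in> {2, 3}"
  shows "\<exists>X Y Z :: int. 5 * (X\<^sup>2 + Y\<^sup>2 + Z\<^sup>2) - (X + Y + Z)\<^sup>2 = 2 * int m"
proof -
  define n k where "n = squarefree_part m" and "k = square_part m"
  have m: "m = n * k\<^sup>2" unfolding n_def k_def by (rule squarefree_decompose)
  have "n mod 5 \<in> {2, 3}"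
  proof -
    have "m mod 5 = (n mod 5) * ((k mod 5) * (k mod 5)) mod 5"
      unfolding m power2_eq_square by (metis mod_mult_eq mod_mult_right_eq)
    moreover have "n mod 5 \<in> {0, 1, 2, 3, 4}" "k mod 5 \<in> {0, 1, 2, 3, 4}" by (simp, presburger)+
    ultimately show ?thesis using assms by (elim insertE emptyE) simp_all
  qed
  then obtain X Y Z :: int where "5 * (X\<^sup>2 + Y\<^sup>2 + Z\<^sup>2) - (X + Y + Z)\<^sup>2 = 2 * int n"
    using squarefree_value_mod_5[of n] by (auto simp: n_def)
  then have "(5 * (X\<^sup>2 + Y\<^sup>2 + Z\<^sup>2) - (X + Y + Z)\<^sup>2) * (int k)\<^sup>2 = 2 * int n * (int k)\<^sup>2" by simp
  then have "5 * ((X * k)\<^sup>2 + (Y * k)\<^sup>2 + (Z * k)\<^sup>2) - (X * k + Y * k + Z * k)\<^sup>2 = 2 * int m"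
    unfolding m by (simp add: power2_eq_square algebra_simps)
  then show ?thesis by blast
qed

text \<open>A representation of 5 a - b^2 by the ternary form determines w from 5 w = b - (X + Y +
  Z), provided that the right side is divisible by 5.\<close>

lemma weighted_Cauchy_lemma:
  fixes a b :: int
  assumes "b \<ge> 0" "\<not> 5 dvd b" "even (a - b)" "b\<^sup>2 < 5 * a" "4 * a < b\<^sup>2 + 2 * b + 5"
  obtains w x y z :: nat where "2 * int w + int x + int y + int z = b"
    "2 * (int w)\<^sup>2 + (int x)\<^sup>2 + (int y)\<^sup>2 + (int z)\<^sup>2 = a"
proof -
  have "even (5 * a - b\<^sup>2)" using assms(3) by simp
  then obtain m' where m': "5 * a - b\<^sup>2 = 2 * m'" by blast
  define m where "m = nat m'"
  have m: "5 * a - b\<^sup>2 = 2 * int m" using m' assms(4) by (simp add: m_def)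
  have sq5: "c * c mod 5 = (c mod 5) * (c mod 5) mod 5" for c :: int by (simp add: mod_mult_eq)
  have res5: "c mod 5 \<in> {0, 1, 2, 3, 4}" for c :: int by (simp, presburger)
  have "int m mod 5 \<in> {2, 3}"
  proof -
    have "b mod 5 \<noteq> 0" using assms(2) by (simp add: dvd_eq_mod_eq_0)
    then have "b * b mod 5 = 1 \<or> b * b mod 5 = 4"
      using res5[of b] unfolding sq5[of b] by (elim insertE emptyE) simp_all
    then show ?thesis using m unfolding power2_eq_square by (simp, presburger)
  qed
  then have "int (m mod 5) \<in> {2, 3}" by (simp only: of_nat_mod of_nat_numeral)
  then have "m mod 5 \<in> {2, 3}" by auto
  then obtain X0 Y0 Z0 :: int where XYZ0: "5 * (X0\<^sup>2 + Y0\<^sup>2 + Z0\<^sup>2) - (X0 + Y0 + Z0)\<^sup>2 = 2 * int m"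
    using value_mod_5 by blast
  define S where "S = X0 + Y0 + Z0"
  have "(b - S) * (b + S) = 5 * (a - (X0\<^sup>2 + Y0\<^sup>2 + Z0\<^sup>2))"
    using m XYZ0 by (simp add: S_def power2_eq_square algebra_simps)
  then have "5 dvd (b - S) * (b + S)" by simp
  \<comment> \<open>The sums S and b have equal squares modulo 5, so they agree up to sign, and the
    form is even in (X, Y, Z).\<close>
  then have "5 dvd b - S \<or> 5 dvd b + S" by (simp add: prime_dvd_mult_iff)
  then obtain X Y Z where XYZ: "5 * (X\<^sup>2 + Y\<^sup>2 + Z\<^sup>2) - (X + Y + Z)\<^sup>2 = 2 * int m" and "5 dvd b - (X + Y + Z)"
  proof
    assume "5 dvd b - S"
    then show ?thesis using XYZ0 that unfolding S_def by blast
  next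
    assume "5 dvd b + S"
    moreover have "(- X0 - Y0 - Z0)\<^sup>2 = (X0 + Y0 + Z0)\<^sup>2" by (simp add: power2_eq_square algebra_simps)
    ultimately show ?thesis using XYZ0 that[of "- X0" "- Y0" "- Z0"] by (simp add: S_def algebra_simps)
  qed
  then obtain w where w: "b - (X + Y + Z) = 5 * w" by blast
  define x y z where "x = w + X" and "y = w + Y" and "z = w + Z"
  have lin: "2 * w + x + y + z = b" using w by (simp add: x_def y_def z_def)
  have "5 * (2 * w\<^sup>2 + x\<^sup>2 + y\<^sup>2 + z\<^sup>2) = (5 * w + (X + Y + Z))\<^sup>2 + (5 * (X\<^sup>2 + Y\<^sup>2 + Z\<^sup>2) - (X + Y + Z)\<^sup>2)"
    by (simp add: x_def y_def z_def power2_eq_square algebra_simps)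
  also have "5 * w + (X + Y + Z) = b" using w by simp
  finally have quad: "2 * w\<^sup>2 + x\<^sup>2 + y\<^sup>2 + z\<^sup>2 = a" using m XYZ by simp
  have "a > 0" using assms(4) zero_le_power2[of b] by linarith
  \<comment> \<open>By Cauchy-Schwarz with weights 2, 1, 1, (b - x)^2 \<le> 4 (a - x^2); for x \<le>
    -1 this gives b^2 + 2 b + 5 \<le> 4 a. For w the weights 1, 1, 1 give the even larger b^2 + 4 b
    + 10 \<le> 3 a.\<close>
  have nonneg: "x \<ge> 0" if "2 * w + x + y + z = b" "2 * w\<^sup>2 + x\<^sup>2 + y\<^sup>2 + z\<^sup>2 = a" for x y z
  proof (rule ccontr)
    assume "\<not> x \<ge> 0"
    then have "x \<le> -1" by simp
    have "0 \<le> 2 * (w - y)\<^sup>2 + 2 * (w - z)\<^sup>2 + (y - z)\<^sup>2" by simp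
    also have "\<dots> = 4 * (2 * w\<^sup>2 + y\<^sup>2 + z\<^sup>2) - (2 * w + y + z)\<^sup>2"
      by (simp add: power2_eq_square algebra_simps)
    also have "2 * w\<^sup>2 + y\<^sup>2 + z\<^sup>2 = a - x\<^sup>2" using that(2) by simp
    also have "2 * w + y + z = b - x" using that(1) by simp
    finally have "b\<^sup>2 + 2 * b * (- x) + 5 * x\<^sup>2 \<le> 4 * a" by (simp add: power2_eq_square algebra_simps)
    moreover have "2 * b * 1 \<le> 2 * b * (- x)" using \<open>x \<le> -1\<close> \<open>b \<ge> 0\<close> by (intro mult_left_mono) auto
    moreover have "1\<^sup>2 \<le> (- x)\<^sup>2" using \<open>x \<le> -1\<close> by (intro power_mono) auto
    ultimately show False using assms(5) by simp
  qed
  have "w \<ge> 0"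
  proof (rule ccontr)
    assume "\<not> w \<ge> 0"
    then have "w \<le> -1" by simp
    have "0 \<le> (x - y)\<^sup>2 + (x - z)\<^sup>2 + (y - z)\<^sup>2" by simp
    also have "\<dots> = 3 * (x\<^sup>2 + y\<^sup>2 + z\<^sup>2) - (x + y + z)\<^sup>2"
      by (simp add: power2_eq_square algebra_simps)
    also have "x\<^sup>2 + y\<^sup>2 + z\<^sup>2 = a - 2 * w\<^sup>2" using quad by simp
    also have "x + y + z = b - 2 * w" using lin by simp
    finally have "b\<^sup>2 + 4 * b * (- w) + 10 * w\<^sup>2 \<le> 3 * a" by (simp add: power2_eq_square algebra_simps)
    moreover have "4 * b * 1 \<le> 4 * b * (- w)" using \<open>w \<le> -1\<close> \<open>b \<ge> 0\<close> by (intro mult_left_mono) auto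
    moreover have "1\<^sup>2 \<le> (- w)\<^sup>2" using \<open>w \<le> -1\<close> by (intro power_mono) auto
    ultimately show False using assms(1,5) \<open>a > 0\<close> by simp
  qed
  moreover have "x \<ge> 0" "y \<ge> 0" "z \<ge> 0"
    using nonneg[of x y z] nonneg[of y x z] nonneg[of z x y] lin quad by (simp_all add: algebra_simps)
  ultimately show ?thesis using that[of "nat w" "nat x" "nat y" "nat z"] lin quad by simp
qed

lemma double_second_pentagonal: "2 * second_pentagonal n = n * (3 * n + 1)"
  by (simp add: second_pentagonal_def)

lemma int_double_second_pentagonal: "2 * int (second_pentagonal n) = 3 * (int n)\<^sup>2 + int n"
proof -
  have "int (2 * second_pentagonal n) = int (n * (3 * n + 1))" by (simp only: double_second_pentagonal)
  then show ?thesis by (simp add: power2_eq_square algebra_simps)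
qed

definition pentagonal_sums :: "nat set" where
  "pentagonal_sums = {2 * second_pentagonal w + second_pentagonal x + second_pentagonal y + second_pentagonal z
    | w x y z. True}"

text \<open>With 3 a = 2 N - b the two inequalities are those of
  \<open>weighted_Cauchy_lemma\<close>, and a has the parity of b automatically.\<close>

lemma pentagonal_sums_memI:
  fixes b :: int
  assumes "0 \<le> b" "b mod 5 \<noteq> 0" "(2 * int N - b) mod 3 = 0"
    and "3 * b * b + 5 * b < 10 * int N" "8 * int N < 3 * b * b + 10 * b + 15"
  shows "N \<in> pentagonal_sums"
proof -
  define a where "a = (2 * int N - b) div 3"
  have a: "3 * a = 2 * int N - b" using assms(3) by (auto simp: a_def)
  obtain w x y z :: nat where wxyz: "2 * int w + int x + int y + int z = b"
    "2 * (int w)\<^sup>2 + (int x)\<^sup>2 + (int y)\<^sup>2 + (int z)\<^sup>2 = a"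
  proof (rule weighted_Cauchy_lemma[of b a])
    show "0 \<le> b" by (rule assms(1))
    show "\<not> 5 dvd b" using assms(2) by presburger
    show "even (a - b)" using a by presburger
    show "b\<^sup>2 < 5 * a" "4 * a < b\<^sup>2 + 2 * b + 5"
      using a assms(4,5) unfolding power2_eq_square by linarith+
  qed
  have "2 * int (2 * second_pentagonal w + second_pentagonal x + second_pentagonal y + second_pentagonal z)
      = 3 * a + b"
    unfolding wxyz[symmetric] using int_double_second_pentagonal[of w] int_double_second_pentagonal[of x]
      int_double_second_pentagonal[of y] int_double_second_pentagonal[of z] by simp
  then have "N = 2 * second_pentagonal w + second_pentagonal x + second_pentagonal y + second_pentagonal z"
    using a by simp
  then show ?thesis unfolding pentagonal_sums_def by blast
qed

lemma pentagonal_sums_large: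
  assumes "N \<ge> 716"
  shows "N \<in> pentagonal_sums"
proof -
  define P where "P b \<longleftrightarrow> 8 * N < 3 * b * b + 10 * b + 15" for b
  define b0 where "b0 = (LEAST b. P b)"
  have "P N" by (cases N) (simp_all add: P_def)
  then have P0: "P b0" unfolding b0_def by (rule LeastI)
  have mono: "P c" if "P b" "b \<le> c" for b c
  proof -
    have "3 * b * b \<le> 3 * c * c" using that by (intro mult_mono) auto
    then show ?thesis using that unfolding P_def by linarith
  qed
  \<comment> \<open>The least N for which this holds is 716. The number 42 is the least c for which
    3 c^2 + 41 c + 138 is below 5/4 (3 c^2 + 10 c + 15), the comparison that closes the upper
    estimate below.\<close>
  have "\<not> P 42" using assms by (simp add: P_def)
  then have "b0 > 42" using mono[OF P0, of 42] by (cases "b0 \<le> 42") auto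
  then obtain c where c: "b0 = Suc c" "c \<ge> 42" by (cases b0) auto
  then have "\<not> P c" unfolding b0_def by (metis lessI not_less_Least)
  then have c_le: "3 * (c * c) + 10 * c + 15 \<le> 8 * N" by (simp add: P_def algebra_simps)
  have "42 * c \<le> c * c" using c(2) by simp
  \<comment> \<open>The first number from \<open>b0\<close> on that is congruent to 2 N modulo
    3.\<close>
  define b1 where "b1 = b0 + (2 * N + 2 * b0) mod 3"
  have b1: "b0 \<le> b1" "b1 \<le> b0 + 2" by (simp_all add: b1_def)
  have "b1 mod 3 = (b0 + (2 * N + 2 * b0)) mod 3" unfolding b1_def by (rule mod_add_right_eq)
  also have "\<dots> = (2 * N + b0 * 3) mod 3" by (simp add: algebra_simps)
  finally have b1_mod: "b1 mod 3 = 2 * N mod 3" by simp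
  \<comment> \<open>\<open>b1\<close> and \<open>b1 + 3\<close> are not both multiples of 5, so an
    offset of at most 5 from \<open>b0\<close> suffices.\<close>
  obtain b where b: "b0 \<le> b" "b \<le> b0 + 5" "b mod 3 = 2 * N mod 3" "b mod 5 \<noteq> 0"
  proof (cases "b1 mod 5 = 0")
    case True
    then have "(b1 + 3) mod 5 \<noteq> 0" by presburger
    then show ?thesis using that[of "b1 + 3"] b1 b1_mod by simp
  next
    case False
    then show ?thesis using that[of b1] b1 b1_mod by simp
  qed
  have "3 * b * b + 5 * b \<le> 3 * (c + 6) * (c + 6) + 5 * (c + 6)"
    using b(2) c(1) by (intro add_mono mult_mono) auto
  also have "\<dots> = 3 * (c * c) + 41 * c + 138" by (simp add: algebra_simps)
  also have "\<dots> < 10 * N" using c_le \<open>42 * c \<le> c * c\<close> c(2) by linarith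
  finally have upper: "3 * b * b + 5 * b < 10 * N" .
  show ?thesis
  proof (rule pentagonal_sums_memI)
    show "0 \<le> int b" by simp
    show "int b mod 5 \<noteq> 0" "(2 * int N - int b) mod 3 = 0" using b(3,4) by presburger+
    have "int (3 * b * b + 5 * b) < int (10 * N)" using upper by (simp only: of_nat_less_iff)
    then show "3 * int b * int b + 5 * int b < 10 * int N" by simp
    have "int (8 * N) < int (3 * b * b + 10 * b + 15)"
      using mono[OF P0 b(1)] unfolding P_def by (simp only: of_nat_less_iff)
    then show "8 * int N < 3 * int b * int b + 10 * int b + 15" by simp
  qed
qed

section \<open>Finite verification below 716\<close>

text \<open>The numbers below 716, other than the exceptions, for which no admissible value
  of \<open>b = 2 w + x + y + z\<close> exists; they are represented explicitly.\<close>

definition sporadic :: "int list" where "sporadic = [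
    0, 7, 9, 10, 13, 14, 16, 17, 19, 22, 24, 29, 32, 35, 37, 38, 40, 41, 44, 45, 47, 48, 53, 56, 61,
    64, 72, 75, 78, 81, 83, 84, 87, 90, 93, 94, 96, 99, 102, 105, 133, 136, 139, 142, 145, 148, 151,
    154, 157, 160, 163, 166, 169, 212, 215, 218, 221, 224, 227, 230, 233, 236, 239, 242, 245, 248,
    309, 312, 315, 318, 321, 324, 327, 330, 333, 336, 339, 342, 427, 430, 433, 436, 439, 442, 445,
    448, 451, 563, 566, 569, 572, 575]"

lemma sporadic_subset: "int N \<in> set sporadic \<Longrightarrow> N \<in> pentagonal_sums"
proof -
  define f where "f = (\<lambda>(w, x, y, z).
    2 * second_pentagonal w + second_pentagonal x + second_pentagonal y + second_pentagonal z)"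
  \<comment> \<open>The quadruples follow the order of \<open>sporadic\<close>, so a single list
    equation checks all of them.\<close>
  define vs :: "(nat \<times> nat \<times> nat \<times> nat) list" where "vs = [
    (0,0,0,0), (0,2,0,0), (0,2,1,0), (1,1,1,1), (1,2,1,0), (0,2,2,0), (0,2,2,1), (0,3,1,0),
    (0,3,1,1), (0,3,2,0), (0,3,2,1), (0,3,2,2), (0,3,3,1), (0,4,2,1), (0,3,3,2), (2,3,2,1),
    (0,4,2,2), (0,4,3,0), (0,5,1,1), (0,3,3,3), (0,5,2,0), (0,4,3,2), (1,5,2,1), (0,4,3,3),
    (0,6,1,1), (0,6,2,0), (0,6,3,0), (1,6,2,2), (0,4,4,4), (0,5,4,3), (0,6,4,0), (0,7,2,0),
    (0,5,5,2), (0,6,4,2), (2,6,3,2), (0,7,3,1), (1,5,4,4), (0,6,5,1), (0,8,1,0), (0,7,4,1),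
    (0,8,4,2), (0,7,6,1), (1,9,2,1), (0,8,5,1), (1,7,6,2), (0,9,3,2), (1,8,5,2), (0,6,6,5),
    (0,7,5,5), (0,7,6,4), (1,8,6,1), (0,8,5,4), (0,7,7,3), (0,10,6,0), (0,8,8,3), (0,9,7,3),
    (0,10,5,4), (0,12,1,0), (0,10,6,3), (1,8,8,4), (0,9,8,2), (0,12,2,2), (0,10,7,2), (0,11,5,3),
    (1,9,8,3), (0,12,4,0), (0,9,9,6), (0,10,8,6), (0,11,9,1), (0,14,3,1), (0,10,9,5), (0,12,8,1),
    (0,11,8,5), (1,9,8,8), (1,9,9,7), (0,10,10,4), (0,11,9,4), (0,11,10,0), (0,14,8,4), (0,13,10,3),
    (0,16,4,3), (0,10,10,9), (0,11,9,9), (0,11,10,8), (0,15,8,0), (0,12,9,8), (0,11,11,7),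
    (0,14,12,5), (0,19,3,0), (0,15,12,1), (0,15,11,5), (0,16,9,6)]"
  have "sporadic = map (\<lambda>v. int (f v)) vs"
    by (simp add: sporadic_def vs_def f_def second_pentagonal_def)
  then have "set sporadic = set (map (\<lambda>v. int (f v)) vs)" by (rule arg_cong)
  then have "set sporadic = (\<lambda>v. int (f v)) ` set vs" unfolding set_map .
  moreover assume "int N \<in> set sporadic"
  ultimately obtain v where "N = f v" by auto
  then show ?thesis by (cases v) (auto simp: f_def pentagonal_sums_def)
qed

text \<open>A triple \<open>(b, l, u)\<close> in the list for the residue class \<open>r\<close> modulo 3 asserts that \<open>b\<close> is admissible
  for all \<open>3 t + r\<close> with \<open>l \<le> t \<le> u\<close>; \<open>b = 0\<close> marks ranges of sporadic or exceptional values.\<close>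

definition windows_0 :: "(int \<times> int \<times> int) list" where "windows_0 = [
    (0,0,1), (3,2,2), (0,3,4), (6,5,7), (0,8,9), (9,10,14), (0,15,16), (12,17,23), (0,24,35),
    (18,36,48), (21,48,64), (24,62,82), (27,78,102), (0,103,114), (33,115,150), (36,136,177),
    (39,159,206), (42,184,238)]"

definition windows_1 :: "(int \<times> int \<times> int) list" where "windows_1 = [
    (0,0,0), (2,1,1), (0,2,7), (8,8,11), (0,12,13), (11,14,19), (0,20,21), (14,22,30), (0,31,31),
    (17,32,43), (0,44,56), (23,57,75), (26,72,95), (29,89,117), (32,108,141), (0,142,150),
    (38,151,196), (41,175,227), (44,201,260)]"

definition windows_2 :: "(int \<times> int \<times> int) list" where "windows_2 = [
    (1,0,0), (0,1,1), (4,2,3), (0,4,5), (7,6,8), (0,9,18), (13,19,26), (0,27,27), (16,28,38),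
    (19,39,52), (22,52,69), (0,70,82), (28,83,109), (31,101,132), (34,121,158), (37,143,186),
    (0,187,191), (43,192,248)]"

text \<open>Each inequality of \<open>pentagonal_sums_memI\<close> is monotone in N, so one is
  tested only at \<open>l\<close> and the other only at \<open>u\<close>.\<close>

definition window_valid :: "int \<Rightarrow> int \<times> int \<times> int \<Rightarrow> bool" where
  "window_valid r = (\<lambda>(b, l, u).
    if b = 0 then \<forall>t\<in>set [l..u]. 3 * t + r \<in> set ([1, 3, 5, 12, 27, 50] @ sporadic)
    else 0 \<le> b \<and> b mod 5 \<noteq> 0 \<and> (b - 2 * r) mod 3 = 0 \<and>
      3 * b * b + 5 * b < 10 * (3 * l + r) \<and> 8 * (3 * u + r) < 3 * b * b + 10 * b + 15)"

text \<open>The argument \<open>c\<close> is the first point not yet known to be covered;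
  \<open>max\<close> lets windows overlap.\<close>

fun chain :: "int \<Rightarrow> (int \<times> int \<times> int) list \<Rightarrow> int \<Rightarrow> bool" where
  "chain c [] e \<longleftrightarrow> e < c"
| "chain c ((b, l, u) # ws) e \<longleftrightarrow> l \<le> c \<and> chain (max c (u + 1)) ws e"

lemma chainD: "chain c ws e \<Longrightarrow> c \<le> t \<Longrightarrow> t \<le> e \<Longrightarrow> \<exists>(b, l, u)\<in>set ws. l \<le> t \<and> t \<le> u"
proof (induction c ws e rule: chain.induct)
  case (2 c b l u ws e)
  then show ?case by (cases "t \<le> u") auto
qed simp

lemma chain_pentagonal_sums:
  assumes "chain 0 ws e" "\<And>v. v \<in> set ws \<Longrightarrow> window_valid r v"
    and N: "int N = 3 * t + r" "0 \<le> t" "t \<le> e" "N \<notin> {1, 3, 5, 12, 27, 50}"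
  shows "N \<in> pentagonal_sums"
proof -
  obtain b l u where "(b, l, u) \<in> set ws" and t: "l \<le> t" "t \<le> u"
    using chainD[OF assms(1) N(2,3)] by blast
  then have valid: "window_valid r (b, l, u)" using assms(2) by blast
  show ?thesis
  proof (cases "b = 0")
    case True
    then have "3 * t + r \<in> set ([1, 3, 5, 12, 27, 50] @ sporadic)"
      using valid t by (auto simp: window_valid_def)
    then have "int N \<in> {1, 3, 5, 12, 27, 50} \<or> int N \<in> set sporadic" unfolding N(1) by auto
    moreover have "int N \<notin> {1, 3, 5, 12, 27, 50}" using N(4) by auto
    ultimately show ?thesis using sporadic_subset by blast
  next
    case False
    then have b: "0 \<le> b" "b mod 5 \<noteq> 0" "(b - 2 * r) mod 3 = 0"
      "3 * b * b + 5 * b < 10 * (3 * l + r)" "8 * (3 * u + r) < 3 * b * b + 10 * b + 15"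
      using valid by (auto simp: window_valid_def)
    show ?thesis
    proof (rule pentagonal_sums_memI[OF b(1,2)])
      show "(2 * int N - b) mod 3 = 0" using b(3) unfolding N(1) by presburger
      have "10 * (3 * l + r) \<le> 10 * int N" "8 * int N \<le> 8 * (3 * u + r)"
        using t by (simp_all add: N(1))
      then show "3 * b * b + 5 * b < 10 * int N" "8 * int N < 3 * b * b + 10 * b + 15"
        using b(4,5) by (auto intro: less_le_trans le_less_trans)
    qed
  qed
qed

lemma pentagonal_sums_small:
  assumes "N < 716" "N \<notin> {1, 3, 5, 12, 27, 50}"
  shows "N \<in> pentagonal_sums"
proof -
  have valid: "\<forall>v\<in>set windows_0. window_valid 0 v" "\<forall>v\<in>set windows_1. window_valid 1 v"
    "\<forall>v\<in>set windows_2. window_valid 2 v"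
    by (simp_all add: windows_0_def windows_1_def windows_2_def window_valid_def sporadic_def
        upto_rec1 del: set_upto)
  \<comment> \<open>715 = 3 * 238 + 1 is the last number to cover, so the class 2 already ends at t
    = 237.\<close>
  have chain: "chain 0 windows_0 238" "chain 0 windows_1 238" "chain 0 windows_2 237"
    by (simp_all add: windows_0_def windows_1_def windows_2_def)
  define t where "t = int N div 3"
  have "0 \<le> t" by (simp add: t_def)
  have "int N < 716" using assms(1) by simp
  then have "int N = 3 * t + 0 \<and> t \<le> 238 \<or> int N = 3 * t + 1 \<and> t \<le> 238 \<or> int N = 3 * t + 2 \<and> t \<le> 237"
    unfolding t_def by presburger
  then show ?thesis
    using chain_pentagonal_sums[OF chain(1)] chain_pentagonal_sums[OF chain(2)]
      chain_pentagonal_sums[OF chain(3)] valid \<open>0 \<le> t\<close> assms(2) by blast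
qed

text \<open>Summands of a number up to 50 are among the six second pentagonal numbers below 50,
  which leaves 6^4 combinations to check.\<close>

lemma pentagonal_sums_exceptions: "pentagonal_sums \<inter> {1, 3, 5, 12, 27, 50} = {}"
proof -
  have small: "second_pentagonal n \<in> {0, 2, 7, 15, 26, 40}" if "second_pentagonal n \<le> 50" for n
  proof -
    have "n \<le> 5"
    proof (rule ccontr)
      assume "\<not> n \<le> 5"
      \<comment> \<open>The next value, at n = 6, is 57 and exceeds 50.\<close>
      then have "6 * (3 * 6 + 1) \<le> n * (3 * n + 1)" by (intro mult_mono) auto
      then show False using that double_second_pentagonal[of n] by simp
    qed
    then have "n \<in> {0, 1, 2, 3, 4, 5}" by auto
    then show ?thesis by (auto simp: second_pentagonal_def)
  qed
  have avoid: "2 * a + b + c + d \<notin> {1, 3, 5, 12, 27, 50}"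
    if "a \<in> {0, 2, 7, 15, 26, 40}" "b \<in> {0, 2, 7, 15, 26, 40}" "c \<in> {0, 2, 7, 15, 26, 40}"
      "d \<in> {0, 2, 7, 15, 26, 40}" for a b c d :: nat
    using that by (elim insertE emptyE) simp_all
  have "2 * second_pentagonal w + second_pentagonal x + second_pentagonal y + second_pentagonal z
      \<notin> {1, 3, 5, 12, 27, 50}" (is "?s \<notin> _") for w x y z
  proof
    assume mem: "?s \<in> {1, 3, 5, 12, 27, 50}"
    then have "?s \<le> 50" by auto
    then have "second_pentagonal w \<le> 50" "second_pentagonal x \<le> 50" "second_pentagonal y \<le> 50"
      "second_pentagonal z \<le> 50" by linarith+
    then show False using avoid[OF small small small small] mem by blast
  qed
  then show ?thesis unfolding pentagonal_sums_def by blast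
qed

theorem corollary7:
  shows "{2 * second_pentagonal w + second_pentagonal x + second_pentagonal y + second_pentagonal z
            | w x y z :: nat. True} = (UNIV :: nat set) - {1, 3, 5, 12, 27, 50}"
proof -
  have "pentagonal_sums = UNIV - {1, 3, 5, 12, 27, 50}"
  proof (intro equalityI subsetI)
    fix N assume "N \<in> pentagonal_sums"
    then show "N \<in> UNIV - {1, 3, 5, 12, 27, 50}" using pentagonal_sums_exceptions by blast
  next
    fix N :: nat assume "N \<in> UNIV - {1, 3, 5, 12, 27, 50}"
    then show "N \<in> pentagonal_sums"
      using pentagonal_sums_small pentagonal_sums_large by (cases "N < 716") auto
  qed
  then show ?thesis by (simp only: pentagonal_sums_def)
qed

end
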